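(* Let $(\mathcal A,\phi)$ be a $W^*$-probability space with $\phi$ a faithful normal tracial state, let $a_1,\dots,a_n\in\mathcal A$ be self-adjoint, and let $1\in\mathcal B\subset\mathcal A$ be a unital $W^*$-subalgebra. Then $$\Phi^*(a_1,\dots,a_n:\mathcal B)<\infty\ \Longrightarrow\ \delta^*(a_1,\dots,a_n:\mathcal B)=n .$$
   Context: **Free Fisher information.** $L^2(\mathcal A,\phi)$ is the completion of $\mathcal A$ in $\|a\|_\phi=\sqrt{\phi(a^*a)}$; for $\mathcal X\subset\mathcal A$, $L^2(\mathcal X,\phi)$ is the $\|\cdot\|_\phi$-closure of the unital $*$-algebra generated by $\mathcal X$. For $\xi\in L^2(\mathcal A,\phi)$ and $a\in\mathcal A$, $\phi(\xi a)$ is defined by continuous extension. A family $(a_i)_{i\in I}\subset\mathcal A$ is self-adjoint if for every $i$ there is $j$ with $a_i^*=a_j$. A family $(\xi_i)_{i\in I}\subset L^2(\mathcal A,\phi)$ is a conjugate system for the self-adjoint family $(a_i)_{i\in I}$ with respect to $\mathcal B$ if $\xi_i\in L^2((a_i)_{i\in I}\cup\mathcal B,\phi)$ for all $i$ and $$\phi(\xi_i b_0a_{i_1}b_1\cdots a_{i_n}b_n)=\sum_{m=1}^n\delta_{i,i_m}\,\phi(b_0a_{i_1}\cdots a_{i_{m-1}}b_{m-1})\,\phi(b_ma_{i_{m+1}}b_{m+1}\cdots a_{i_n}b_n)$$ for all $n\ge0$, $b_0,\dots,b_n\in\mathcal B$, $i,i_1,\dots,i_n\in I$ (for $n=0$ this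 reads $\phi(\xi_ib_0)=0$). It is unique if it exists. Set $\Phi^*((a_i)_{i\in I}:\mathcal B)=\sum_{i\in I}\|\xi_i\|_\phi^2$ if a conjugate system exists and $+\infty$ otherwise. **Entropy and entropy dimension.** For self-adjoint $a_1,\dots,a_n\in\mathcal A$, $$\chi^*(a_1,\dots,a_n:\mathcal B)=\frac12\int_0^\infty\Big(\frac n{1+t}-\Phi^*(a_1+\sqrt tS_1,\dots,a_n+\sqrt tS_n:\mathcal B)\Big)\,dt+\frac n2\log(2\pi e),$$ $$\delta^*(a_1,\dots,a_n:\mathcal B)=n+\limsup_{\epsilon\to0^+}\frac{\chi^*(a_1+\epsilon S_1,\dots,a_n+\epsilon S_n:\mathcal B)}{|\log\epsilon|},$$ where $S_1,\dots,S_n$ are standard semicircular elements (self-adjoint, semicircular distribution of mean $0$ and variance $1$) such that $\{S_1\},\dots,\{S_n\},\{a_1,\dots,a_n\}\cup\mathcal B$ are free with respect to $\phi$ (enlarging $\mathcal A$ if necessary). *)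

theory Defs
  imports "HOL-Analysis.Analysis"
begin

section \<open>Tracial \<open>W\<^sup>*\<close>-probability spaces\<close>

text \<open>Unital \<open>C\<^sup>*\<close>-algebras. Real scaling, the norm and completeness come from the library classes;
  complex scaling and the involution are added.\<close>

class cstar_algebra = real_normed_algebra_1 + banach +
  fixes scaleC :: "complex \<Rightarrow> 'a \<Rightarrow> 'a"  (infixr \<open>*\<^sub>C\<close> 75)
    and star :: "'a \<Rightarrow> 'a"
  assumes scaleC_add_right: "c *\<^sub>C (x + y) = c *\<^sub>C x + c *\<^sub>C y"
    and scaleC_add_left: "(c + d) *\<^sub>C x = c *\<^sub>C x + d *\<^sub>C x"
    and scaleC_scaleC: "c *\<^sub>C d *\<^sub>C x = (c * d) *\<^sub>C x"
    and scaleC_of_real: "complex_of_real r *\<^sub>C x = r *\<^sub>R x"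
    and mult_scaleC_left: "(c *\<^sub>C x) * y = c *\<^sub>C (x * y)"
    and mult_scaleC_right: "x * (c *\<^sub>C y) = c *\<^sub>C (x * y)"
    and norm_scaleC: "norm (c *\<^sub>C x) = cmod c * norm x"
    and star_star: "star (star x) = x"
    and star_add: "star (x + y) = star x + star y"
    and star_scaleC: "star (c *\<^sub>C x) = cnj c *\<^sub>C star x"
    and star_mult: "star (x * y) = star y * star x"
    and norm_star_mult_self: "norm (star x * x) = (norm x)\<^sup>2"

definition norm_dual :: "('a::cstar_algebra \<Rightarrow> complex) set" where
  "norm_dual = {\<omega>. bounded_linear \<omega> \<and> (\<forall>c x. \<omega> (c *\<^sub>C x) = c * \<omega> x)}"

text \<open>A \<open>W\<^sup>*\<close>-algebra is a \<open>C\<^sup>*\<close>-algebra that is the dual of a Banach space (Sakai). Here the Banach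
  space is presented as a norm-closed subspace \<open>P\<close> of the dual of the algebra, and the canonical map
  from the algebra to the dual of \<open>P\<close> is required to be an isometric bijection. Every predual
  has this form, and \<open>P\<close> is then unique (it consists of the normal functionals), so that carrying
  it as a parameter adds no structure.\<close>

definition wstar_algebra :: "('a::cstar_algebra \<Rightarrow> complex) set \<Rightarrow> bool" where
  "wstar_algebra P \<longleftrightarrow>
     P \<subseteq> norm_dual \<and>
     (\<lambda>x. 0) \<in> P \<and>
     (\<forall>\<omega>\<in>P. \<forall>\<psi>\<in>P. (\<lambda>x. \<omega> x + \<psi> x) \<in> P) \<and>
     (\<forall>c. \<forall>\<omega>\<in>P. (\<lambda>x. c * \<omega> x) \<in> P) \<and>
     (\<forall>\<omega>\<in>norm_dual. (\<forall>e>0. \<exists>\<psi>\<in>P. onorm (\<lambda>x. \<omega> x - \<psi> x) < e) \<longrightarrow> \<omega> \<in> P) \<and>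
     (\<forall>x. norm x = (SUP \<omega>\<in>{\<omega>\<in>P. onorm \<omega> \<le> 1}. cmod (\<omega> x))) \<and>
     (\<forall>F :: ('a \<Rightarrow> complex) \<Rightarrow> complex.
        (\<forall>\<omega>\<in>P. \<forall>\<psi>\<in>P. F (\<lambda>x. \<omega> x + \<psi> x) = F \<omega> + F \<psi>) \<and>
        (\<forall>c. \<forall>\<omega>\<in>P. F (\<lambda>x. c * \<omega> x) = c * F \<omega>) \<and>
        (\<exists>K. \<forall>\<omega>\<in>P. cmod (F \<omega>) \<le> K * onorm \<omega>)
        \<longrightarrow> (\<exists>x. \<forall>\<omega>\<in>P. F \<omega> = \<omega> x))"

definition weak_star_topology :: "('a::cstar_algebra \<Rightarrow> complex) set \<Rightarrow> 'a topology" where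
  "weak_star_topology P = topology_generated_by {\<omega> -` U |\<omega> U. \<omega> \<in> P \<and> open U}"

definition unital_star_subalgebra :: "'a::cstar_algebra set \<Rightarrow> bool" where
  "unital_star_subalgebra B \<longleftrightarrow>
     1 \<in> B \<and> (\<forall>x\<in>B. \<forall>y\<in>B. x + y \<in> B \<and> x * y \<in> B) \<and> (\<forall>c. \<forall>x\<in>B. c *\<^sub>C x \<in> B) \<and> (\<forall>x\<in>B. star x \<in> B)"

definition unital_wstar_subalgebra ::
    "('a::cstar_algebra \<Rightarrow> complex) set \<Rightarrow> 'a set \<Rightarrow> bool" where
  "unital_wstar_subalgebra P B \<longleftrightarrow>
     unital_star_subalgebra B \<and> closedin (weak_star_topology P) B"

text \<open>Normality of \<open>\<phi>\<close> is membership in the predual.\<close>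

definition tracial_wstar_probability_space ::
    "('a::cstar_algebra \<Rightarrow> complex) set \<Rightarrow> ('a \<Rightarrow> complex) \<Rightarrow> bool" where
  "tracial_wstar_probability_space P \<phi> \<longleftrightarrow>
     wstar_algebra P \<and>
     \<phi> \<in> P \<and>
     \<phi> 1 = 1 \<and>
     (\<forall>x. \<phi> (star x * x) \<in> \<real>\<^sub>\<ge>\<^sub>0) \<and>
     (\<forall>x. \<phi> (star x * x) = 0 \<longrightarrow> x = 0) \<and>
     (\<forall>x y. \<phi> (x * y) = \<phi> (y * x))"

text \<open>An enlargement \<open>\<iota>\<close> of \<open>('a, \<phi>)\<close> to \<open>('b, \<tau>)\<close>: a normal unital \<open>*\<close>-homomorphism preserving the
  state (hence injective, as \<open>\<phi>\<close> is faithful).\<close>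

definition wstar_enlargement ::
    "('a::cstar_algebra \<Rightarrow> complex) set \<Rightarrow> ('a \<Rightarrow> complex) \<Rightarrow>
     ('b::cstar_algebra \<Rightarrow> complex) set \<Rightarrow> ('b \<Rightarrow> complex) \<Rightarrow> ('a \<Rightarrow> 'b) \<Rightarrow> bool" where
  "wstar_enlargement P \<phi> Q \<tau> \<iota> \<longleftrightarrow>
     tracial_wstar_probability_space P \<phi> \<and>
     tracial_wstar_probability_space Q \<tau> \<and>
     \<iota> 1 = 1 \<and>
     (\<forall>x y. \<iota> (x + y) = \<iota> x + \<iota> y) \<and>
     (\<forall>c x. \<iota> (c *\<^sub>C x) = c *\<^sub>C \<iota> x) \<and>
     (\<forall>x y. \<iota> (x * y) = \<iota> x * \<iota> y) \<and>
     (\<forall>x. \<iota> (star x) = star (\<iota> x)) \<and>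
     (\<forall>\<omega>\<in>Q. \<omega> \<circ> \<iota> \<in> P) \<and>
     \<tau> \<circ> \<iota> = \<phi>"


section \<open>The Hilbert space \<open>L\<^sup>2\<close>\<close>

definition phi_norm :: "('a::cstar_algebra \<Rightarrow> complex) \<Rightarrow> 'a \<Rightarrow> real" where
  "phi_norm \<phi> a = sqrt (Re (\<phi> (star a * a)))"

text \<open>The completion is realised by Cauchy sequences modulo null sequences, so that a vector of
  \<open>L\<^sup>2\<close> is a set of sequences in the algebra.\<close>

definition L2_cauchy :: "('a::cstar_algebra \<Rightarrow> complex) \<Rightarrow> (nat \<Rightarrow> 'a) set" where
  "L2_cauchy \<phi> = {X. \<forall>e>0. \<exists>N. \<forall>k\<ge>N. \<forall>l\<ge>N. phi_norm \<phi> (X k - X l) < e}"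

definition L2_rel :: "('a::cstar_algebra \<Rightarrow> complex) \<Rightarrow> ((nat \<Rightarrow> 'a) \<times> (nat \<Rightarrow> 'a)) set" where
  "L2_rel \<phi> = {(X, Y). X \<in> L2_cauchy \<phi> \<and> Y \<in> L2_cauchy \<phi> \<and>
                        (\<lambda>k. phi_norm \<phi> (X k - Y k)) \<longlonglongrightarrow> 0}"

definition L2 :: "('a::cstar_algebra \<Rightarrow> complex) \<Rightarrow> (nat \<Rightarrow> 'a) set set" where
  "L2 \<phi> = L2_cauchy \<phi> // L2_rel \<phi>"

definition L2_norm :: "('a::cstar_algebra \<Rightarrow> complex) \<Rightarrow> (nat \<Rightarrow> 'a) set \<Rightarrow> real" where
  "L2_norm \<phi> \<xi> = (THE r. \<forall>X\<in>\<xi>. (\<lambda>k. phi_norm \<phi> (X k)) \<longlonglongrightarrow> r)"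

text \<open>\<open>\<phi>(\<xi> a)\<close> by continuous extension.\<close>

definition L2_apply ::
    "('a::cstar_algebra \<Rightarrow> complex) \<Rightarrow> (nat \<Rightarrow> 'a) set \<Rightarrow> 'a \<Rightarrow> complex" where
  "L2_apply \<phi> \<xi> a = (THE z. \<forall>X\<in>\<xi>. (\<lambda>k. \<phi> (X k * a)) \<longlonglongrightarrow> z)"

text \<open>A vector lies in the closure of the \<open>*\<close>-algebra generated by \<open>X\<close> iff it is represented by some
  sequence from that algebra.\<close>

definition L2_generated ::
    "('a::cstar_algebra \<Rightarrow> complex) \<Rightarrow> 'a set \<Rightarrow> (nat \<Rightarrow> 'a) set set" where
  "L2_generated \<phi> X = {\<xi>\<in>L2 \<phi>. \<exists>Y\<in>\<xi>. range Y \<subseteq> unital_star_subalgebra hull X}"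


section \<open>Freeness and semicircular elements\<close>

definition free_family ::
    "('a::cstar_algebra \<Rightarrow> complex) \<Rightarrow> 'i set \<Rightarrow> ('i \<Rightarrow> 'a set) \<Rightarrow> bool" where
  "free_family \<phi> I X \<longleftrightarrow>
     (\<forall>ws :: ('i \<times> 'a) list.
        ws \<noteq> [] \<and> distinct_adj (map fst ws) \<and>
        (\<forall>(i, x) \<in> set ws. i \<in> I \<and> x \<in> unital_star_subalgebra hull X i \<and> \<phi> x = 0)
        \<longrightarrow> \<phi> (prod_list (map snd ws)) = 0)"

definition standard_semicircular :: "('a::cstar_algebra \<Rightarrow> complex) \<Rightarrow> 'a \<Rightarrow> bool" where
  "standard_semicircular \<phi> s \<longleftrightarrow>
     star s = s \<and>
     (\<forall>k. \<phi> (s ^ k) = complex_of_real (LBINT x:{-2..2}. x ^ k * (sqrt (4 - x\<^sup>2) / (2 * pi))))"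

text \<open>\<open>S 1, \<dots>, S n\<close> are standard semicircular, and \<open>{S 1}, \<dots>, {S n}, X\<close> are free; \<open>X\<close> has index \<open>0\<close>.\<close>

definition free_semicirculars ::
    "('a::cstar_algebra \<Rightarrow> complex) \<Rightarrow> nat \<Rightarrow> (nat \<Rightarrow> 'a) \<Rightarrow> 'a set \<Rightarrow> bool" where
  "free_semicirculars \<phi> n S X \<longleftrightarrow>
     (\<forall>i\<in>{1..n}. standard_semicircular \<phi> (S i)) \<and>
     free_family \<phi> {0..n} (\<lambda>i. if i = 0 then X else {S i})"


section \<open>Free Fisher information\<close>

text \<open>\<open>nc_word a b\<^sub>0 [(i\<^sub>1, b\<^sub>1), \<dots>, (i\<^sub>n, b\<^sub>n)]\<close> is \<open>b\<^sub>0 a\<^bsub>i\<^sub>1\<^esub> b\<^sub>1 \<cdots> a\<^bsub>i\<^sub>n\<^esub> b\<^sub>n\<close>.\<close>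

definition nc_word :: "('i \<Rightarrow> 'a::monoid_mult) \<Rightarrow> 'a \<Rightarrow> ('i \<times> 'a) list \<Rightarrow> 'a" where
  "nc_word a b w = b * prod_list (map (\<lambda>(i, c). a i * c) w)"

definition self_adjoint_family :: "'i set \<Rightarrow> ('i \<Rightarrow> 'a::cstar_algebra) \<Rightarrow> bool" where
  "self_adjoint_family I a \<longleftrightarrow> (\<forall>i\<in>I. \<exists>j\<in>I. star (a i) = a j)"

definition conjugate_system ::
    "('a::cstar_algebra \<Rightarrow> complex) \<Rightarrow> 'i set \<Rightarrow> ('i \<Rightarrow> 'a) \<Rightarrow> 'a set \<Rightarrow>
     ('i \<Rightarrow> (nat \<Rightarrow> 'a) set) \<Rightarrow> bool" where
  "conjugate_system \<phi> I a B \<xi> \<longleftrightarrow>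
     self_adjoint_family I a \<and>
     (\<forall>i\<in>I. \<xi> i \<in> L2_generated \<phi> (a ` I \<union> B)) \<and>
     (\<forall>i\<in>I. \<forall>b\<in>B. \<forall>w \<in> lists (I \<times> B).
        L2_apply \<phi> (\<xi> i) (nc_word a b w) =
        (\<Sum>m<length w. if fst (w ! m) = i
           then \<phi> (nc_word a b (take m w)) * \<phi> (nc_word a (snd (w ! m)) (drop (Suc m) w))
           else 0))"

text \<open>The choice of the conjugate system is immaterial, as it is unique on \<open>I\<close>.\<close>

definition free_fisher ::
    "('a::cstar_algebra \<Rightarrow> complex) \<Rightarrow> 'i set \<Rightarrow> ('i \<Rightarrow> 'a) \<Rightarrow> 'a set \<Rightarrow> ennreal" where
  "free_fisher \<phi> I a B =
     (if \<exists>\<xi>. conjugate_system \<phi> I a B \<xi>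
      then (\<Sum>\<^sub>\<infinity>i\<in>I. ennreal ((L2_norm \<phi> ((SOME \<xi>. conjugate_system \<phi> I a B \<xi>) i))\<^sup>2))
      else \<infinity>)"


section \<open>Free entropy and free entropy dimension\<close>

text \<open>The Lebesgue integral of an extended real function, as the integral of the positive part
  minus the integral of the negative part (\<^const>\<open>e2ennreal\<close> sends negative values to \<open>0\<close>).\<close>

definition ereal_integral :: "'x measure \<Rightarrow> ('x \<Rightarrow> ereal) \<Rightarrow> ereal" where
  "ereal_integral M f =
     enn2ereal (\<integral>\<^sup>+ x. e2ennreal (f x) \<partial>M) - enn2ereal (\<integral>\<^sup>+ x. e2ennreal (- f x) \<partial>M)"

text \<open>The semicircular elements entering the definitions are arguments: \<open>chi_star \<phi> n a B S\<close> is
  \<open>\<chi>\<^sup>*(a\<^sub>1, \<dots>, a\<^sub>n : B)\<close> whenever \<open>free_semicirculars \<phi> n S (a ` {1..n} \<union> B)\<close>, whatever the choice of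
  \<open>S\<close>. The positive part of the integrand has a finite integral, so that the difference in
  \<^const>\<open>ereal_integral\<close> is not \<open>\<infinity> - \<infinity>\<close>.\<close>

definition chi_star ::
    "('a::cstar_algebra \<Rightarrow> complex) \<Rightarrow> nat \<Rightarrow> (nat \<Rightarrow> 'a) \<Rightarrow> 'a set \<Rightarrow> (nat \<Rightarrow> 'a) \<Rightarrow> ereal" where
  "chi_star \<phi> n a B S =
     ereal (1 / 2) *
       ereal_integral (restrict_space lborel {0<..})
         (\<lambda>t. ereal (real n / (1 + t)) -
               enn2ereal (free_fisher \<phi> {1..n} (\<lambda>i. a i + sqrt t *\<^sub>R S i) B))
     + ereal (real n / 2 * ln (2 * pi * exp 1))"

text \<open>Here \<open>S\<close> perturbs \<open>a\<close>, and \<open>T \<epsilon>\<close> is the family used to compute \<open>\<chi>\<^sup>*\<close> of the perturbation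
  \<open>a\<^sub>1 + \<epsilon> S\<^sub>1, \<dots>, a\<^sub>n + \<epsilon> S\<^sub>n\<close>.\<close>

definition delta_star ::
    "('a::cstar_algebra \<Rightarrow> complex) \<Rightarrow> nat \<Rightarrow> (nat \<Rightarrow> 'a) \<Rightarrow> 'a set \<Rightarrow> (nat \<Rightarrow> 'a) \<Rightarrow>
     (real \<Rightarrow> nat \<Rightarrow> 'a) \<Rightarrow> ereal" where
  "delta_star \<phi> n a B S T =
     ereal (real n) +
     Limsup (at_right 0)
       (\<lambda>\<epsilon>. chi_star \<phi> n (\<lambda>i. a i + \<epsilon> *\<^sub>R S i) B (T \<epsilon>) / ereal \<bar>ln \<epsilon>\<bar>)"

end

theory Submission
  imports Defs
begin

text \<open>
  It suffices to bound \<open>\<chi>\<^sup>*(a + \<epsilon>S : B)\<close> from above and below by constants that do not depend on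
  \<open>\<epsilon> \<in> (0, 1)\<close>, as \<open>\<bar>ln \<epsilon>\<bar>\<close> tends to infinity. Write \<open>\<Phi>(t)\<close> for the free Fisher information of
  \<open>a + \<epsilon>S + \<surd>t T\<close> relative to \<open>B\<close>. The integrand \<open>n / (1 + t) - \<Phi>(t)\<close> is bounded by a constant times
  \<open>1 / (1 + t)\<^sup>2\<close>, because of three estimates:
  \<^item> \<open>\<Phi>(t) \<le> \<Phi>\<^sup>*(a : B)\<close>, since a conjugate variable of \<open>a\<close> satisfies the conjugate relation for every
    free perturbation of \<open>a\<close> (\<open>score_vector_free_perturbation\<close>, applied to \<open>S\<close> and then to \<open>T\<close>);
  \<^item> \<open>\<Phi>(t) \<le> n / t\<close>, since \<open>T\<^sub>i / \<surd>t\<close> satisfies the conjugate relation for \<open>a + \<epsilon>S + \<surd>t T\<close>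
    (\<open>score_vector_semicircular\<close>);
  \<^item> \<open>\<Phi>(t) \<ge> n / (c + t)\<close>, where \<open>c\<close> bounds the second moments of \<open>a + \<epsilon>S\<close> (\<open>free_fisher_ge\<close>).
  The first estimate controls small \<open>t\<close>, the second makes the negative part of the integrand
  integrable at infinity, and the third makes the positive part integrable there.

  In the upper estimates, the vector that satisfies the conjugate relation lies outside the space
  generated by the perturbed variables. Its orthogonal projection to that space is the conjugate
  variable, which therefore exists and is not longer (\<open>Riesz_representation_subalgebra\<close>,
  \<open>representing_norm_le\<close>).

  Both upper estimates come from one fact (\<open>free_extension_of_conjugate_relation\<close>): a conjugate
  relation on an algebra \<open>D\<close> persists on the algebra generated by \<open>D\<close> and a free algebra \<open>E\<close>, with the
  derivation extended by zero on \<open>E\<close>. In the first estimate, \<open>D\<close> is generated by \<open>a\<close> and \<open>B\<close>, and \<open>E\<close>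
  by the semicircular family. In the second, \<open>D\<close> is generated by \<open>T\<^sub>i\<close> alone, on which the
  relation is the recurrence of the Catalan numbers, and \<open>E\<close> by everything else. The derivation is
  handled as a relation, the set \<open>diff_graph\<close> of pairs of an element and a value of its difference
  quotient. Passing from the generators of \<open>D\<close> and \<open>E\<close> to words in the perturbed variables is then
  closure of this set under sums and products.
\<close>

section \<open>Involutive algebra\<close>

lemma scaleC_zero_left [simp]: "0 *\<^sub>C (x::'a::cstar_algebra) = 0"
  using scaleC_of_real[of 0 x] by simp

lemma scaleC_one [simp]: "1 *\<^sub>C (x::'a::cstar_algebra) = x"
  using scaleC_of_real[of 1 x] by simp

lemma scaleC_minus_one: "(-1) *\<^sub>C (x::'a::cstar_algebra) = - x"
  using scaleC_of_real[of "-1" x] by simp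

lemma scaleR_scaleC: "r *\<^sub>R (x::'a::cstar_algebra) = complex_of_real r *\<^sub>C x"
  by (simp add: scaleC_of_real)

lemma scaleC_zero_right [simp]: "c *\<^sub>C (0::'a::cstar_algebra) = 0"
  using scaleC_scaleC[of c 0 "0::'a"] by simp

lemma scaleC_minus_right: "c *\<^sub>C (- x) = - (c *\<^sub>C (x::'a::cstar_algebra))"
  by (metis (no_types, lifting) mult.commute scaleC_minus_one scaleC_scaleC)

lemma scaleC_diff_right: "c *\<^sub>C (x - y) = c *\<^sub>C x - c *\<^sub>C (y::'a::cstar_algebra)"
  using scaleC_add_right[of c x "- y"] by (simp add: scaleC_minus_right)

lemma star_zero [simp]: "star (0::'a::cstar_algebra) = 0"
  using star_scaleC[of 0 "0::'a"] by simp

lemma star_one [simp]: "star (1::'a::cstar_algebra) = 1"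
  by (metis mult.right_neutral mult_1 star_mult star_star)

lemma star_scaleR: "star (r *\<^sub>R x) = r *\<^sub>R star (x::'a::cstar_algebra)"
  by (simp add: scaleR_scaleC star_scaleC)

abbreviation star_hull :: "'a::cstar_algebra set \<Rightarrow> 'a set" where
  "star_hull X \<equiv> unital_star_subalgebra hull X"

lemma unital_star_subalgebraD:
  assumes "unital_star_subalgebra M"
  shows "1 \<in> M" "x \<in> M \<Longrightarrow> y \<in> M \<Longrightarrow> x + y \<in> M" "x \<in> M \<Longrightarrow> y \<in> M \<Longrightarrow> x * y \<in> M"
    "x \<in> M \<Longrightarrow> c *\<^sub>C x \<in> M" "x \<in> M \<Longrightarrow> star x \<in> M" "x \<in> M \<Longrightarrow> - x \<in> M"
    "x \<in> M \<Longrightarrow> y \<in> M \<Longrightarrow> x - y \<in> M" "x \<in> M \<Longrightarrow> r *\<^sub>R x \<in> M"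
proof -
  show *: "1 \<in> M" "x \<in> M \<Longrightarrow> y \<in> M \<Longrightarrow> x + y \<in> M" "x \<in> M \<Longrightarrow> y \<in> M \<Longrightarrow> x * y \<in> M"
    and sc: "x \<in> M \<Longrightarrow> c *\<^sub>C x \<in> M" and "x \<in> M \<Longrightarrow> star x \<in> M" for x y c
    using assms by (simp_all add: unital_star_subalgebra_def)
  show mi: "x \<in> M \<Longrightarrow> - x \<in> M" for x
    using sc[of x "-1"] by (simp add: scaleC_minus_one)
  show "x \<in> M \<Longrightarrow> y \<in> M \<Longrightarrow> x - y \<in> M"
    using *(2)[of x "- y"] mi[of y] by simp
  show "x \<in> M \<Longrightarrow> r *\<^sub>R x \<in> M"
    using sc by (simp add: scaleR_scaleC)
qed

lemma star_hull_subalgebra: "unital_star_subalgebra (star_hull X)"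
proof (rule hull_in[where S = unital_star_subalgebra])
  fix \<T> :: "'a set set"
  assume "\<forall>M\<in>\<T>. unital_star_subalgebra M"
  then show "unital_star_subalgebra (\<Inter>\<T>)"
    unfolding unital_star_subalgebra_def by (intro conjI ballI allI) simp_all
qed

lemma star_hull_self: "unital_star_subalgebra M \<Longrightarrow> star_hull M = M"
  by (rule hull_same)

text \<open>A generated algebra is reached by left multiplications alone, because the elements which
  preserve a subspace \<open>V\<close> from the left, together with their adjoints, form a \<open>*\<close>-algebra. This
  replaces every reduction of a product of two sums of words by that of a letter times a word.\<close>

lemma star_hull_subset_left:
  assumes one: "1 \<in> V" and add: "\<And>u v. u \<in> V \<Longrightarrow> v \<in> V \<Longrightarrow> u + v \<in> V"
    and scale: "\<And>c u. u \<in> V \<Longrightarrow> c *\<^sub>C u \<in> V"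
    and left: "\<And>x v. x \<in> X \<Longrightarrow> v \<in> V \<Longrightarrow> x * v \<in> V"
    and left_star: "\<And>x v. x \<in> X \<Longrightarrow> v \<in> V \<Longrightarrow> star x * v \<in> V"
  shows "star_hull X \<subseteq> V"
proof -
  let ?W = "{u. \<forall>v\<in>V. u * v \<in> V \<and> star u * v \<in> V}"
  have "unital_star_subalgebra ?W"
    unfolding unital_star_subalgebra_def
    using add scale by (simp add: star_add star_mult star_scaleC star_star distrib_right
        mult_scaleC_left mult.assoc)
  moreover have "X \<subseteq> ?W" using left left_star by auto
  ultimately have "star_hull X \<subseteq> ?W" by (simp add: hull_minimal)
  then show ?thesis using one by fastforce
qed


section \<open>Tracial states\<close>

locale tracial_state =
  fixes \<tau> :: "'a::cstar_algebra \<Rightarrow> complex"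
  assumes tr_add: "\<tau> (x + y) = \<tau> x + \<tau> y"
    and tr_scaleC: "\<tau> (c *\<^sub>C x) = c * \<tau> x"
    and tr_one [simp]: "\<tau> 1 = 1"
    and tr_nonneg: "\<tau> (star x * x) \<in> \<real>\<^sub>\<ge>\<^sub>0"
    and tr_commute: "\<tau> (x * y) = \<tau> (y * x)"
begin

lemma tr_zero [simp]: "\<tau> 0 = 0"
  using tr_scaleC[of 0 0] by simp

lemma tr_minus: "\<tau> (- x) = - \<tau> x"
  using tr_scaleC[of "-1" x] by (simp add: scaleC_minus_one)

lemma tr_diff: "\<tau> (x - y) = \<tau> x - \<tau> y"
  using tr_add[of x "- y"] by (simp add: tr_minus)

lemma tr_scaleR: "\<tau> (r *\<^sub>R x) = complex_of_real r * \<tau> x"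
  by (simp add: scaleR_scaleC tr_scaleC)

lemma tr_square_real: "Im (\<tau> (star x * x)) = 0" and tr_square_nonneg: "Re (\<tau> (star x * x)) \<ge> 0"
  using tr_nonneg[of x] by (auto simp: complex_nonneg_Reals_iff)

lemma tr_star: "\<tau> (star x) = cnj (\<tau> x)"
proof -
  \<comment> \<open>Polarization against \<open>1\<close>: the squares of \<open>x + 1\<close> and of \<open>x + \<i>\<close> have real trace.\<close>
  have "Im (\<tau> (star (x + 1) * (x + 1))) = 0" "Im (\<tau> (star (x + \<i> *\<^sub>C 1) * (x + \<i> *\<^sub>C 1))) = 0"
    "Im (\<tau> (star x * x)) = 0"
    by (rule tr_square_real)+
  then have "Im (\<tau> (star x)) + Im (\<tau> x) = 0" "Re (\<tau> (star x)) = Re (\<tau> x)"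
    by (simp_all add: star_add star_scaleC distrib_left distrib_right mult_scaleC_left
        mult_scaleC_right tr_add tr_scaleC scaleC_scaleC)
  then show ?thesis by (simp add: complex_eq_iff)
qed

lemma phi_norm_square: "(phi_norm \<tau> x)\<^sup>2 = Re (\<tau> (star x * x))"
  by (simp add: phi_norm_def tr_square_nonneg)

lemma phi_norm_nonneg [simp]: "0 \<le> phi_norm \<tau> x"
  by (simp add: phi_norm_def tr_square_nonneg)

lemma tr_star_self: "\<tau> (star x * x) = complex_of_real ((phi_norm \<tau> x)\<^sup>2)"
  using tr_square_real[of x] by (simp add: phi_norm_square complex_eq_iff)

lemma phi_norm_star: "phi_norm \<tau> (star x) = phi_norm \<tau> x"
  unfolding phi_norm_def by (simp add: star_star tr_commute)

lemma phi_norm_scaleC: "phi_norm \<tau> (c *\<^sub>C x) = cmod c * phi_norm \<tau> x"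
proof -
  have "star (c *\<^sub>C x) * (c *\<^sub>C x) = complex_of_real ((cmod c)\<^sup>2) *\<^sub>C (star x * x)"
    by (simp only: star_scaleC mult_scaleC_left mult_scaleC_right scaleC_scaleC
        complex_norm_square mult.commute)
  then have "Re (\<tau> (star (c *\<^sub>C x) * (c *\<^sub>C x))) = (cmod c)\<^sup>2 * Re (\<tau> (star x * x))"
    by (simp only: tr_scaleC Re_complex_of_real Im_complex_of_real times_complex.sel
        mult_zero_left diff_zero)
  then show ?thesis unfolding phi_norm_def by (simp add: real_sqrt_mult)
qed

lemma phi_norm_scaleR: "phi_norm \<tau> (r *\<^sub>R x) = \<bar>r\<bar> * phi_norm \<tau> x"
  by (simp add: scaleR_scaleC phi_norm_scaleC)

lemma phi_norm_minus: "phi_norm \<tau> (- x) = phi_norm \<tau> x"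
  using phi_norm_scaleC[of "-1" x] by (simp add: scaleC_minus_one)

lemma phi_norm_diff_commute: "phi_norm \<tau> (x - y) = phi_norm \<tau> (y - x)"
  using phi_norm_minus[of "x - y"] by simp

lemma phi_norm_add_scaleR_square:
  "(phi_norm \<tau> (x + s *\<^sub>R y))\<^sup>2
    = (phi_norm \<tau> x)\<^sup>2 + 2 * s * Re (\<tau> (star x * y)) + s\<^sup>2 * (phi_norm \<tau> y)\<^sup>2"
proof -
  have "Re (\<tau> (star y * x)) = Re (\<tau> (star x * y))"
    using tr_star[of "star x * y"] by (simp add: star_mult star_star)
  then show ?thesis
    by (simp add: phi_norm_square star_add star_scaleR distrib_left distrib_right tr_add tr_scaleR
        power2_eq_square[of s])
qed

lemma Cauchy_Schwarz_Re: "Re (\<tau> (star x * y)) \<le> phi_norm \<tau> x * phi_norm \<tau> y"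
proof -
  let ?r = "Re (\<tau> (star x * y))" and ?a = "phi_norm \<tau> x" and ?b = "phi_norm \<tau> y"
  have q: "0 \<le> ?a\<^sup>2 + 2 * s * ?r + s\<^sup>2 * ?b\<^sup>2" for s
    using phi_norm_add_scaleR_square[of x s y] zero_le_power2[of "phi_norm \<tau> (x + s *\<^sub>R y)"] by simp
  show ?thesis
  proof (cases "?b = 0")
    case True
    have "?r \<le> 0"
    proof (rule ccontr)
      assume "\<not> ?r \<le> 0"
      then have "2 * (- (?a\<^sup>2 + 1) / (2 * ?r)) * ?r = - (?a\<^sup>2 + 1)" by simp
      then show False
        using q[of "- (?a\<^sup>2 + 1) / (2 * ?r)"] True by simp
    qed
    with True show ?thesis by simp
  next
    case False
    then have b: "?b\<^sup>2 > 0" by simp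
    have "2 * (- ?r / ?b\<^sup>2) * ?r = - 2 * (?r\<^sup>2 / ?b\<^sup>2)"
      by (simp add: power2_eq_square[of ?r])
    moreover have "(- ?r / ?b\<^sup>2)\<^sup>2 * ?b\<^sup>2 = ?r\<^sup>2 / ?b\<^sup>2"
      using b by (simp only: power_divide power2_minus) (simp add: power2_eq_square)
    ultimately have "?r\<^sup>2 / ?b\<^sup>2 \<le> ?a\<^sup>2"
      using q[of "- ?r / ?b\<^sup>2"] by linarith
    then have "?r\<^sup>2 \<le> (?a * ?b)\<^sup>2"
      using b by (simp only: pos_divide_le_eq power_mult_distrib)
    then show ?thesis by (rule power2_le_imp_le) simp
  qed
qed

lemma Cauchy_Schwarz: "cmod (\<tau> (x * y)) \<le> phi_norm \<tau> x * phi_norm \<tau> y"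
proof -
  obtain c where c: "cmod c = 1" "c * \<tau> (x * y) = complex_of_real (cmod (\<tau> (x * y)))"
  proof (cases "\<tau> (x * y) = 0")
    case True
    then show ?thesis using that[of 1] by simp
  next
    case False
    let ?z = "\<tau> (x * y)"
    have "?z * cnj ?z = complex_of_real (cmod ?z) * complex_of_real (cmod ?z)"
      by (simp only: complex_norm_square[symmetric] power2_eq_square of_real_mult)
    then have "cnj ?z / complex_of_real (cmod ?z) * ?z = complex_of_real (cmod ?z)"
      using False by (simp add: mult.commute)
    moreover have "cmod (cnj ?z / complex_of_real (cmod ?z)) = 1" using False by (simp add: norm_divide)
    ultimately show ?thesis using that by blast
  qed
  have "cmod (\<tau> (x * y)) = Re (\<tau> (star (star x) * (c *\<^sub>C y)))"
    using c(2) by (simp add: star_star mult_scaleC_right tr_scaleC)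
  also have "\<dots> \<le> phi_norm \<tau> (star x) * phi_norm \<tau> (c *\<^sub>C y)"
    by (rule Cauchy_Schwarz_Re)
  finally show ?thesis by (simp add: phi_norm_star phi_norm_scaleC c(1))
qed

lemma phi_norm_triangle: "phi_norm \<tau> (x + y) \<le> phi_norm \<tau> x + phi_norm \<tau> y"
proof -
  have "(phi_norm \<tau> (x + y))\<^sup>2 \<le> (phi_norm \<tau> x + phi_norm \<tau> y)\<^sup>2"
    using phi_norm_add_scaleR_square[of x 1 y] Cauchy_Schwarz_Re[of x y]
    by (simp add: power2_sum)
  then show ?thesis by (rule power2_le_imp_le) simp
qed

lemma phi_norm_triangle_diff: "\<bar>phi_norm \<tau> x - phi_norm \<tau> y\<bar> \<le> phi_norm \<tau> (x - y)"
  using phi_norm_triangle[of "x - y" y] phi_norm_triangle[of "y - x" x]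
  by (simp add: phi_norm_diff_commute)

end


section \<open>Vectors of \<open>L\<^sup>2\<close> as Cauchy sequences\<close>

context tracial_state
begin

lemma tr_mult_diff_le: "cmod (\<tau> (x * w) - \<tau> (y * w)) \<le> phi_norm \<tau> (x - y) * phi_norm \<tau> w"
  using Cauchy_Schwarz[of "x - y" w] by (simp add: left_diff_distrib tr_diff)

lemma L2_cauchyD:
  assumes "X \<in> L2_cauchy \<tau>" "e > 0"
  obtains N where "\<And>k l. k \<ge> N \<Longrightarrow> l \<ge> N \<Longrightarrow> phi_norm \<tau> (X k - X l) < e"
  using assms unfolding L2_cauchy_def by blast

lemma L2_cauchy_const: "(\<lambda>k. x) \<in> L2_cauchy \<tau>"
  by (simp add: L2_cauchy_def phi_norm_def)

lemma convergent_tr_mult: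
  assumes "X \<in> L2_cauchy \<tau>"
  shows "convergent (\<lambda>k. \<tau> (X k * w))"
proof -
  have "Cauchy (\<lambda>k. \<tau> (X k * w))"
  proof (rule metric_CauchyI)
    fix e :: real assume "e > 0"
    then have d: "e / (phi_norm \<tau> w + 1) > 0"
      by (simp add: add_nonneg_pos)
    obtain N where N: "\<And>k l. k \<ge> N \<Longrightarrow> l \<ge> N \<Longrightarrow> phi_norm \<tau> (X k - X l) < e / (phi_norm \<tau> w + 1)"
      using L2_cauchyD[OF assms d] by blast
    have "dist (\<tau> (X k * w)) (\<tau> (X l * w)) < e" if "k \<ge> N" "l \<ge> N" for k l
    proof -
      have "dist (\<tau> (X k * w)) (\<tau> (X l * w)) \<le> phi_norm \<tau> (X k - X l) * phi_norm \<tau> w"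
        using tr_mult_diff_le by (simp add: dist_norm)
      also have "\<dots> \<le> phi_norm \<tau> (X k - X l) * (phi_norm \<tau> w + 1)"
        by (simp add: mult_left_mono)
      also have "\<dots> < e"
        using N[OF that] by (simp add: pos_less_divide_eq add_nonneg_pos)
      finally show ?thesis .
    qed
    then show "\<exists>N. \<forall>k\<ge>N. \<forall>l\<ge>N. dist (\<tau> (X k * w)) (\<tau> (X l * w)) < e" by blast
  qed
  then show ?thesis by (rule Cauchy_convergent)
qed

lemma convergent_phi_norm:
  assumes "X \<in> L2_cauchy \<tau>"
  shows "convergent (\<lambda>k. phi_norm \<tau> (X k))"
proof -
  have "Cauchy (\<lambda>k. phi_norm \<tau> (X k))"
  proof (rule metric_CauchyI)
    fix e :: real assume "e > 0"
    then obtain N where "\<And>k l. k \<ge> N \<Longrightarrow> l \<ge> N \<Longrightarrow> phi_norm \<tau> (X k - X l) < e"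
      using L2_cauchyD[OF assms] by blast
    then show "\<exists>N. \<forall>k\<ge>N. \<forall>l\<ge>N. dist (phi_norm \<tau> (X k)) (phi_norm \<tau> (X l)) < e"
      using phi_norm_triangle_diff by (metis dist_real_def order_le_less_trans)
  qed
  then show ?thesis by (rule Cauchy_convergent)
qed

lemma L2_members:
  assumes "\<xi> \<in> L2 \<tau>" "Y \<in> \<xi>" "Z \<in> \<xi>"
  shows "Y \<in> L2_cauchy \<tau>" "(\<lambda>k. phi_norm \<tau> (Y k - Z k)) \<longlonglongrightarrow> 0"
proof -
  obtain X where X: "(X, Y) \<in> L2_rel \<tau>" "(X, Z) \<in> L2_rel \<tau>"
    using assms unfolding L2_def by (elim quotientE) auto
  then show "Y \<in> L2_cauchy \<tau>" by (simp add: L2_rel_def)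
  have le: "norm (phi_norm \<tau> (Y k - Z k)) \<le> phi_norm \<tau> (X k - Y k) + phi_norm \<tau> (X k - Z k)" for k
    using phi_norm_triangle[of "Y k - X k" "X k - Z k"] by (simp add: phi_norm_diff_commute)
  have "(\<lambda>k. phi_norm \<tau> (X k - Y k)) \<longlonglongrightarrow> 0" "(\<lambda>k. phi_norm \<tau> (X k - Z k)) \<longlonglongrightarrow> 0"
    using X by (simp_all add: L2_rel_def)
  then have "(\<lambda>k. phi_norm \<tau> (X k - Y k) + phi_norm \<tau> (X k - Z k)) \<longlonglongrightarrow> 0"
    by (rule tendsto_add_zero)
  then show "(\<lambda>k. phi_norm \<tau> (Y k - Z k)) \<longlonglongrightarrow> 0"
    by (rule Lim_null_comparison[OF always_eventually[OF allI[OF le]]])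
qed

lemma L2_class:
  assumes "Y \<in> L2_cauchy \<tau>"
  shows "L2_rel \<tau> `` {Y} \<in> L2 \<tau>" "Y \<in> L2_rel \<tau> `` {Y}"
  using assms by (auto simp: L2_def quotient_def L2_rel_def phi_norm_def)

lemma L2_apply_tendsto:
  assumes "\<xi> \<in> L2 \<tau>" "Y \<in> \<xi>"
  shows "(\<lambda>k. \<tau> (Y k * w)) \<longlonglongrightarrow> L2_apply \<tau> \<xi> w"
proof -
  obtain z where z: "(\<lambda>k. \<tau> (Y k * w)) \<longlonglongrightarrow> z"
    using convergent_tr_mult[OF L2_members(1)[OF assms assms(2)]] by (auto simp: convergent_def)
  have "(\<lambda>k. \<tau> (X k * w)) \<longlonglongrightarrow> z" if "X \<in> \<xi>" for X
  proof -
    have "(\<lambda>k. phi_norm \<tau> (X k - Y k) * phi_norm \<tau> w) \<longlonglongrightarrow> 0"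
      using L2_members(2)[OF assms(1) that assms(2)] by (rule tendsto_mult_left_zero)
    then have "(\<lambda>k. \<tau> (X k * w) - \<tau> (Y k * w)) \<longlonglongrightarrow> 0"
      by (rule Lim_null_comparison[rotated]) (simp add: tr_mult_diff_le)
    then show ?thesis by (rule Lim_transform[OF z])
  qed
  moreover have "z' = z" if "\<forall>X\<in>\<xi>. (\<lambda>k. \<tau> (X k * w)) \<longlonglongrightarrow> z'" for z'
    using that z assms(2) LIMSEQ_unique by blast
  ultimately have "L2_apply \<tau> \<xi> w = z"
    unfolding L2_apply_def by (intro the_equality) blast+
  then show ?thesis using z by simp
qed

lemma L2_norm_tendsto:
  assumes "\<xi> \<in> L2 \<tau>" "Y \<in> \<xi>"
  shows "(\<lambda>k. phi_norm \<tau> (Y k)) \<longlonglongrightarrow> L2_norm \<tau> \<xi>"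
proof -
  obtain z where z: "(\<lambda>k. phi_norm \<tau> (Y k)) \<longlonglongrightarrow> z"
    using convergent_phi_norm[OF L2_members(1)[OF assms assms(2)]] by (auto simp: convergent_def)
  have "(\<lambda>k. phi_norm \<tau> (X k)) \<longlonglongrightarrow> z" if "X \<in> \<xi>" for X
  proof -
    have "(\<lambda>k. phi_norm \<tau> (X k) - phi_norm \<tau> (Y k)) \<longlonglongrightarrow> 0"
      using L2_members(2)[OF assms(1) that assms(2)]
      by (rule Lim_null_comparison[rotated]) (simp add: phi_norm_triangle_diff)
    then show ?thesis by (rule Lim_transform[OF z])
  qed
  moreover have "z' = z" if "\<forall>X\<in>\<xi>. (\<lambda>k. phi_norm \<tau> (X k)) \<longlonglongrightarrow> z'" for z'
    using that z assms(2) LIMSEQ_unique by blast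
  ultimately have "L2_norm \<tau> \<xi> = z"
    unfolding L2_norm_def by (intro the_equality) blast+
  then show ?thesis using z by simp
qed

text \<open>Riesz representation inside the closure of a \<open>*\<close>-subalgebra \<open>M\<close>: the representing vector
  minimises \<open>\<parallel>y\<parallel>\<^sup>2 - 2 Re F(y\<^sup>*)\<close> over \<open>y \<in> M\<close>. By the parallelogram law a minimising sequence is
  Cauchy, and perturbing it in the directions \<open>v\<close> and \<open>\<i>v\<close> identifies its limit. For the functional
  given by a vector \<open>\<zeta>\<close>, this is the orthogonal projection of \<open>\<zeta>\<close> to the closure of \<open>M\<close>.\<close>

lemma Riesz_representation_subalgebra:
  assumes M: "unital_star_subalgebra M"
    and F_add: "\<And>x y. F (x + y) = F x + F y" and F_scale: "\<And>c x. F (c *\<^sub>C x) = c * F x"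
    and F_bound: "\<And>w. w \<in> M \<Longrightarrow> cmod (F w) \<le> C * phi_norm \<tau> w"
  obtains Y where "range Y \<subseteq> M" "Y \<in> L2_cauchy \<tau>" "\<And>w. w \<in> M \<Longrightarrow> (\<lambda>k. \<tau> (Y k * w)) \<longlonglongrightarrow> F w"
proof -
  note M' = unital_star_subalgebraD[OF M]
  define J where "J y = (phi_norm \<tau> y)\<^sup>2 - 2 * Re (F (star y))" for y
  have F_scaleR: "F (s *\<^sub>R x) = complex_of_real s * F x" for s x
    by (simp add: scaleR_scaleC F_scale)
  have J_lower: "- C\<^sup>2 \<le> J y" if "y \<in> M" for y
  proof -
    have "Re (F (star y)) \<le> C * phi_norm \<tau> y"
      using F_bound[OF M'(5)[OF that]] complex_Re_le_cmod[of "F (star y)"] by (simp add: phi_norm_star)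
    moreover have "0 \<le> (phi_norm \<tau> y)\<^sup>2 + C\<^sup>2 - 2 * (C * phi_norm \<tau> y)"
      using zero_le_power2[of "phi_norm \<tau> y - C"] by (simp add: power2_diff mult.commute)
    ultimately show ?thesis unfolding J_def by linarith
  qed
  have bdd: "bdd_below (J ` M)" by (rule bdd_belowI2[where m = "- C\<^sup>2"]) (rule J_lower)
  define j where "j = Inf (J ` M)"
  have j_le: "j \<le> J y" if "y \<in> M" for y
    unfolding j_def using bdd that by (simp add: cInf_lower)
  have "\<exists>y\<in>M. J y < j + 1 / (real k + 1)" for k
  proof -
    have "Inf (J ` M) < j + 1 / (real k + 1)" by (simp add: j_def)
    then show ?thesis using cInf_lessD[of "J ` M"] M'(1) by blast
  qed
  then obtain Y where Y: "\<And>k. Y k \<in> M" "\<And>k. J (Y k) < j + 1 / (real k + 1)" by metis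
  have J_perturb: "J (y + s *\<^sub>R v)
      = J y + 2 * s * Re (\<tau> (y * star v) - F (star v)) + s\<^sup>2 * (phi_norm \<tau> v)\<^sup>2" for y s v
  proof -
    have "Re (\<tau> (star y * v)) = Re (\<tau> (y * star v))"
      using tr_star[of "star y * v"] by (simp add: star_mult star_star tr_commute)
    then show ?thesis
      by (simp add: J_def phi_norm_add_scaleR_square star_add star_scaleR F_add F_scaleR algebra_simps)
  qed
  have parallelogram: "(phi_norm \<tau> (y - z))\<^sup>2 = 2 * J y + 2 * J z - 4 * J (y + (1/2) *\<^sub>R (z - y))" for y z
  proof -
    have z: "y + 1 *\<^sub>R (z - y) = z" by simp
    have "J z = J y + 2 * Re (\<tau> (y * star (z - y)) - F (star (z - y))) + (phi_norm \<tau> (z - y))\<^sup>2"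
      using J_perturb[of y 1 "z - y"] by (simp only: z) simp
    moreover have "J (y + (1/2) *\<^sub>R (z - y))
      = J y + Re (\<tau> (y * star (z - y)) - F (star (z - y))) + (phi_norm \<tau> (z - y))\<^sup>2 / 4"
      using J_perturb[of y "1/2" "z - y"] by (simp add: power2_eq_square[of "1/2"])
    ultimately show ?thesis by (simp add: phi_norm_diff_commute[of y z])
  qed
  have dist_le: "(phi_norm \<tau> (Y k - Y l))\<^sup>2 \<le> 2 / (real k + 1) + 2 / (real l + 1)" for k l
    using parallelogram[of "Y k" "Y l"] Y(2)[of k] Y(2)[of l]
      j_le[of "Y k + (1/2) *\<^sub>R (Y l - Y k)"] M'(2,7,8) Y(1) by simp
  have "Y \<in> L2_cauchy \<tau>"
    unfolding L2_cauchy_def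
  proof (clarify)
    fix e :: real assume e: "e > 0"
    then obtain N where N: "4 / e\<^sup>2 < real N" using reals_Archimedean2 by blast
    have "phi_norm \<tau> (Y k - Y l) < e" if "k \<ge> N" "l \<ge> N" for k l
    proof -
      have "0 < 4 / e\<^sup>2" using e by simp
      then have N0: "real N > 0" using N by linarith
      have "2 / (real k + 1) < 2 / real N" "2 / (real l + 1) < 2 / real N"
        using that N0 by (intro divide_strict_left_mono; simp)+
      then have "(phi_norm \<tau> (Y k - Y l))\<^sup>2 < 4 / real N"
        using dist_le[of k l] by simp
      also have "\<dots> < e\<^sup>2" using N N0 e by (simp add: field_simps)
      finally show ?thesis using e by (simp add: power2_less_imp_less)
    qed
    then show "\<exists>N. \<forall>k\<ge>N. \<forall>l\<ge>N. phi_norm \<tau> (Y k - Y l) < e" by blast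
  qed
  moreover have "(\<lambda>k. \<tau> (Y k * w)) \<longlonglongrightarrow> F w" if w: "w \<in> M" for w
  proof -
    have Re_lim: "(\<lambda>k. Re (\<tau> (Y k * star v) - F (star v))) \<longlonglongrightarrow> 0" if v: "v \<in> M" for v
    proof -
      define q where "q = (phi_norm \<tau> v)\<^sup>2 + 1"
      have q: "q > 0" "(phi_norm \<tau> v)\<^sup>2 \<le> q" by (simp_all add: q_def add_nonneg_pos)
      have le: "(Re (\<tau> (Y k * star v) - F (star v)))\<^sup>2 \<le> q * (1 / (real k + 1))" for k
      proof -
        define d where "d = Re (\<tau> (Y k * star v) - F (star v))"
        have "j \<le> J (Y k + (- d / q) *\<^sub>R v)"
          by (intro j_le M'(2,8) Y(1) v)
        then have "0 \<le> 1 / (real k + 1) + 2 * (- d / q) * d + (- d / q)\<^sup>2 * (phi_norm \<tau> v)\<^sup>2"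
          using Y(2)[of k] J_perturb[of "Y k" "- d / q" v] unfolding d_def[symmetric] by linarith
        also have "(- d / q)\<^sup>2 * (phi_norm \<tau> v)\<^sup>2 \<le> (- d / q)\<^sup>2 * q"
          by (intro mult_left_mono q(2)) simp
        also have "(- d / q)\<^sup>2 * q = d\<^sup>2 / q"
          using q(1) by (simp add: power2_eq_square)
        also have "2 * (- d / q) * d = - 2 * (d\<^sup>2 / q)"
          by (simp add: power2_eq_square[of d])
        finally have "d\<^sup>2 / q \<le> 1 / (real k + 1)" by simp
        then show ?thesis
          unfolding d_def[symmetric] using q(1) by (simp add: pos_divide_le_eq mult.commute)
      qed
      have "(\<lambda>k. q * (1 / (real k + 1))) \<longlonglongrightarrow> 0"
        by (rule tendsto_mult_right_zero) (use LIMSEQ_inverse_real_of_nat in \<open>simp add: inverse_eq_divide add.commute\<close>)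
      then have "(\<lambda>k. (Re (\<tau> (Y k * star v) - F (star v)))\<^sup>2) \<longlonglongrightarrow> 0"
        by (rule Lim_null_comparison[rotated])
          (simp only: real_norm_def abs_power2, intro always_eventually allI le)
      then show ?thesis by (simp add: power_tendsto_0_iff)
    qed
    have "(\<lambda>k. Re (\<tau> (Y k * w) - F w)) \<longlonglongrightarrow> 0"
      using Re_lim[OF M'(5)[OF w]] by (simp add: star_star)
    moreover have "(\<lambda>k. Im (\<tau> (Y k * w) - F w)) \<longlonglongrightarrow> 0"
      using Re_lim[OF M'(4)[OF M'(5)[OF w], of \<i>]]
      by (simp add: star_star star_scaleC F_scale tr_scaleC mult_scaleC_right)
    ultimately have "(\<lambda>k. \<tau> (Y k * w) - F w) \<longlonglongrightarrow> 0"
      by (simp add: tendsto_complex_iff)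
    then show ?thesis by (simp add: LIM_zero_iff)
  qed
  ultimately show ?thesis using that Y(1) by blast
qed

text \<open>A vector in the closure of \<open>M\<close> is tested on \<open>M\<close> by its own adjoint, so its norm is bounded by
  that of any vector with the same pairings against \<open>M\<close>.\<close>

lemma representing_norm_le:
  assumes Y: "range Y \<subseteq> M" "Y \<in> L2_cauchy \<tau>" "(\<lambda>k. phi_norm \<tau> (Y k)) \<longlonglongrightarrow> s"
    and C: "C \<ge> 0" and M: "unital_star_subalgebra M"
    and bound: "\<And>w. w \<in> M \<Longrightarrow> (\<lambda>k. \<tau> (Y k * w)) \<longlonglongrightarrow> F w \<and> cmod (F w) \<le> C * phi_norm \<tau> w"
  shows "s \<le> C"
proof (rule field_le_epsilon)
  fix e :: real assume e: "e > 0"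
  obtain N where N: "\<And>k l. k \<ge> N \<Longrightarrow> l \<ge> N \<Longrightarrow> phi_norm \<tau> (Y k - Y l) < e"
    using L2_cauchyD[OF Y(2) e] by blast
  have "phi_norm \<tau> (Y l) \<le> C + e" if l: "l \<ge> N" for l
  proof -
    let ?w = "star (Y l)" and ?r = "phi_norm \<tau> (Y l)"
    have w: "?w \<in> M" using unital_star_subalgebraD(5)[OF M] Y(1) by blast
    have "(\<lambda>k. cmod (\<tau> (Y k * ?w)) + e * ?r) \<longlonglongrightarrow> cmod (F ?w) + e * ?r"
      using bound[OF w] by (intro tendsto_intros) auto
    moreover have "?r\<^sup>2 \<le> cmod (\<tau> (Y k * ?w)) + e * ?r" if "k \<ge> N" for k
    proof -
      have "?r\<^sup>2 = cmod (\<tau> (Y l * ?w))"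
        by (simp add: tr_commute[of "Y l"] tr_star_self norm_power)
      also have "\<dots> \<le> cmod (\<tau> (Y k * ?w)) + cmod (\<tau> (Y l * ?w) - \<tau> (Y k * ?w))"
        by (rule norm_triangle_sub)
      also have "cmod (\<tau> (Y l * ?w) - \<tau> (Y k * ?w)) \<le> phi_norm \<tau> (Y l - Y k) * ?r"
        using tr_mult_diff_le[of "Y l" ?w "Y k"] by (simp add: phi_norm_star)
      also have "\<dots> \<le> e * ?r"
        using N[OF l that] by (intro mult_right_mono) auto
      finally show ?thesis by simp
    qed
    ultimately have "?r\<^sup>2 \<le> cmod (F ?w) + e * ?r"
      by (intro LIMSEQ_le_const) auto
    also have "\<dots> \<le> (C + e) * ?r"
      using bound[OF w] by (simp add: phi_norm_star distrib_right)
    finally have "?r * ?r \<le> (C + e) * ?r" by (simp add: power2_eq_square)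
    then show ?thesis
      using C e phi_norm_nonneg[of "Y l"] by (cases "?r = 0") (auto simp: mult_le_cancel_right)
  qed
  then show "s \<le> C + e"
    by (intro LIMSEQ_le_const2[OF Y(3)]) blast
qed

end


section \<open>The free difference quotient as a relation\<close>

text \<open>A two-sided linear functional \<open>\<alpha>\<close> stands for a tensor \<open>\<Sum> p \<otimes> q\<close> through
  \<open>\<alpha> y z = \<Sum> \<tau>(y p) \<tau>(q z)\<close>; the right and left actions on the tensor become
  \<open>\<alpha> y (v z)\<close> and \<open>\<alpha> (y u) z\<close>, and \<open>(\<tau> \<otimes> \<tau>)\<close> of the tensor is \<open>\<alpha> 1 1\<close>.\<close>

definition biadditive :: "('a::cstar_algebra \<Rightarrow> 'a \<Rightarrow> complex) \<Rightarrow> bool" where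
  "biadditive \<alpha> \<longleftrightarrow>
     (\<forall>y y' z. \<alpha> (y + y') z = \<alpha> y z + \<alpha> y' z) \<and> (\<forall>y z z'. \<alpha> y (z + z') = \<alpha> y z + \<alpha> y z') \<and>
     (\<forall>c y z. \<alpha> (c *\<^sub>C y) z = c * \<alpha> y z) \<and> (\<forall>c y z. \<alpha> y (c *\<^sub>C z) = c * \<alpha> y z)"

lemma biadditiveD:
  assumes "biadditive \<alpha>"
  shows "\<alpha> (y + y') z = \<alpha> y z + \<alpha> y' z" "\<alpha> y (z + z') = \<alpha> y z + \<alpha> y z'"
    "\<alpha> (c *\<^sub>C y) z = c * \<alpha> y z" "\<alpha> y (c *\<^sub>C z) = c * \<alpha> y z"
  using assms by (simp_all add: biadditive_def)

text \<open>An element is paired with a candidate for its difference quotient, so that both sides of a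
  conjugate relation \<open>F u = \<alpha> 1 1\<close> extend linearly at once.\<close>

inductive_set pair_span ::
    "('a::cstar_algebra \<times> ('a \<Rightarrow> 'a \<Rightarrow> complex)) set \<Rightarrow> ('a \<times> ('a \<Rightarrow> 'a \<Rightarrow> complex)) set"
  for N where
  base: "(u, \<alpha>) \<in> N \<Longrightarrow> (u, \<alpha>) \<in> pair_span N"
| add: "(u, \<alpha>) \<in> pair_span N \<Longrightarrow> (v, \<beta>) \<in> pair_span N \<Longrightarrow> (u + v, \<lambda>y z. \<alpha> y z + \<beta> y z) \<in> pair_span N"
| scale: "(u, \<alpha>) \<in> pair_span N \<Longrightarrow> (c *\<^sub>C u, \<lambda>y z. c * \<alpha> y z) \<in> pair_span N"

lemma pair_span_eval:
  assumes "(u, \<alpha>) \<in> pair_span N"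
    and "\<And>u \<alpha>. (u, \<alpha>) \<in> N \<Longrightarrow> F u = \<alpha> 1 1"
    and "\<And>x y. F (x + y) = F x + F y" "\<And>c x. F (c *\<^sub>C x) = c * (F x :: complex)"
  shows "F u = \<alpha> 1 1"
  using assms(1) by induction (simp_all add: assms(2-4))

lemma nc_word_Nil [simp]: "nc_word x b [] = b"
  and nc_word_Cons: "nc_word x b ((j, c) # w) = b * (x j * nc_word x c w)"
  and nc_word_mult: "nc_word x (b' * b) w = b' * nc_word x b w"
  for x :: "'i \<Rightarrow> 'a::monoid_mult"
  by (simp_all add: nc_word_def mult.assoc)

context tracial_state
begin

text \<open>The graph of the derivation on the algebra generated by the elements \<open>g\<close> with
  \<open>(g, \<kappa>) \<in> Gen\<close> that sends \<open>g\<close> to \<open>\<kappa> (1 \<otimes> 1)\<close>. It is a relation and not a function because the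
  generators may satisfy algebraic relations.\<close>

inductive_set diff_graph ::
    "('a \<times> complex) set \<Rightarrow> ('a \<times> ('a \<Rightarrow> 'a \<Rightarrow> complex)) set" for Gen where
  one: "(1, \<lambda>y z. 0) \<in> diff_graph Gen"
| add: "(u, \<alpha>) \<in> diff_graph Gen \<Longrightarrow> (v, \<beta>) \<in> diff_graph Gen \<Longrightarrow>
    (u + v, \<lambda>y z. \<alpha> y z + \<beta> y z) \<in> diff_graph Gen"
| scale: "(u, \<alpha>) \<in> diff_graph Gen \<Longrightarrow> (c *\<^sub>C u, \<lambda>y z. c * \<alpha> y z) \<in> diff_graph Gen"
| gen: "(g, \<kappa>) \<in> Gen \<Longrightarrow> (u, \<alpha>) \<in> diff_graph Gen \<Longrightarrow>
    (g * u, \<lambda>y z. \<kappa> * \<tau> y * \<tau> (u * z) + \<alpha> (y * g) z) \<in> diff_graph Gen"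

lemma diff_graph_biadditive: "(u, \<alpha>) \<in> diff_graph Gen \<Longrightarrow> biadditive \<alpha>"
  by (induction rule: diff_graph.induct)
    (simp_all add: biadditive_def tr_add tr_scaleC distrib_left distrib_right mult_scaleC_left
      mult_scaleC_right algebra_simps)

lemma diff_graph_mult:
  assumes "(u, \<alpha>) \<in> diff_graph Gen" and v: "(v, \<beta>) \<in> diff_graph Gen"
  shows "(u * v, \<lambda>y z. \<alpha> y (v * z) + \<beta> (y * u) z) \<in> diff_graph Gen"
  using assms(1)
proof induction
  case one
  then show ?case using v by simp
next
  case (add u \<alpha> u' \<alpha>')
  have "(\<lambda>y z. (\<alpha> y (v * z) + \<beta> (y * u) z) + (\<alpha>' y (v * z) + \<beta> (y * u') z))
      = (\<lambda>y z. \<alpha> y (v * z) + \<alpha>' y (v * z) + \<beta> (y * (u + u')) z)"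
    by (intro ext) (simp add: distrib_left biadditiveD[OF diff_graph_biadditive[OF v]])
  then show ?case using diff_graph.add[OF add.IH] by (simp add: distrib_right)
next
  case (scale u \<alpha> c)
  have "(\<lambda>y z. c * (\<alpha> y (v * z) + \<beta> (y * u) z)) = (\<lambda>y z. c * \<alpha> y (v * z) + \<beta> (y * (c *\<^sub>C u)) z)"
    by (intro ext) (simp add: distrib_left mult_scaleC_right biadditiveD[OF diff_graph_biadditive[OF v]])
  then show ?case using diff_graph.scale[OF scale.IH, of c] by (simp add: mult_scaleC_left)
next
  case (gen g \<kappa> u \<alpha>)
  then show ?case using diff_graph.gen[OF gen.hyps(1) gen.IH] by (simp add: mult.assoc add.assoc)
qed

lemma diff_graph_generator: "(g, \<kappa>) \<in> Gen \<Longrightarrow> (g, \<lambda>y z. \<kappa> * \<tau> y * \<tau> z) \<in> diff_graph Gen"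
  using diff_graph.gen[OF _ diff_graph.one, of g \<kappa> Gen] by simp

lemma diff_graph_center:
  assumes "(u, \<alpha>) \<in> diff_graph Gen"
  shows "(u + c *\<^sub>C 1, \<alpha>) \<in> diff_graph Gen"
  using diff_graph.add[OF assms diff_graph.scale[OF diff_graph.one, of c]] by simp

lemma diff_graph_fst:
  assumes "(u, \<alpha>) \<in> diff_graph Gen" and D: "unital_star_subalgebra D" "fst ` Gen \<subseteq> D"
  shows "u \<in> D"
  using assms(1)
  by induction (use D(2) in \<open>force intro: unital_star_subalgebraD[OF D(1)]\<close>)+

text \<open>Both legs of the tensors lie in the generated algebra, so a tensor is killed by a functional
  on one leg that vanishes on this algebra.\<close>

lemma diff_graph_null_left:
  assumes "(u, \<alpha>) \<in> diff_graph Gen" and D: "unital_star_subalgebra D" "fst ` Gen \<subseteq> D"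
    and "\<And>p. p \<in> D \<Longrightarrow> \<tau> (y * p) = 0"
  shows "\<alpha> y z = 0"
  using assms(1,4)
proof (induction arbitrary: y)
  case (gen g \<kappa> u \<alpha>)
  have g: "g \<in> D" using gen.hyps(1) D(2) by force
  have "\<tau> (y * g * p) = 0" if "p \<in> D" for p
    using gen.prems unital_star_subalgebraD(3)[OF D(1) g that] by (simp add: mult.assoc)
  then show ?case
    using gen.IH gen.prems[of 1] unital_star_subalgebraD(1)[OF D(1)] by simp
qed auto

lemma diff_graph_null_right:
  assumes "(u, \<alpha>) \<in> diff_graph Gen" and D: "unital_star_subalgebra D" "fst ` Gen \<subseteq> D"
    and "\<And>p. p \<in> D \<Longrightarrow> \<tau> (p * z) = 0"
  shows "\<alpha> y z = 0"
  using assms(1)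
proof (induction arbitrary: y)
  case (gen g \<kappa> u \<alpha>)
  then show ?case using assms(4) diff_graph_fst[OF gen.hyps(2) D] by simp
qed auto

text \<open>To identify the graph with the span of a set \<open>N\<close> of normal forms, it suffices to rewrite a
  generator times a normal form; products of normal forms never occur.\<close>

lemma diff_graph_subset_pair_span:
  assumes one: "(1, \<lambda>y z. 0) \<in> pair_span N"
    and left: "\<And>g \<kappa> u \<alpha>. (g, \<kappa>) \<in> Gen \<Longrightarrow> (u, \<alpha>) \<in> N \<Longrightarrow>
      (g * u, \<lambda>y z. \<kappa> * \<tau> y * \<tau> (u * z) + \<alpha> (y * g) z) \<in> pair_span N"
  shows "diff_graph Gen \<subseteq> pair_span N"
proof -
  have span_left: "(g * u, \<lambda>y z. \<kappa> * \<tau> y * \<tau> (u * z) + \<alpha> (y * g) z) \<in> pair_span N"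
    if "(u, \<alpha>) \<in> pair_span N" and g: "(g, \<kappa>) \<in> Gen" for g \<kappa> u \<alpha>
    using that(1)
  proof induction
    case (base u \<alpha>)
    then show ?case using left g by simp
  next
    case (add u \<alpha> v \<beta>)
    have "(\<lambda>y z. (\<kappa> * \<tau> y * \<tau> (u * z) + \<alpha> (y * g) z) + (\<kappa> * \<tau> y * \<tau> (v * z) + \<beta> (y * g) z))
        = (\<lambda>y z. \<kappa> * \<tau> y * \<tau> ((u + v) * z) + (\<alpha> (y * g) z + \<beta> (y * g) z))"
      by (intro ext) (simp add: distrib_left distrib_right tr_add)
    then show ?case using pair_span.add[OF add.IH] by (simp add: distrib_left)
  next
    case (scale u \<alpha> c)
    have "(\<lambda>y z. c * (\<kappa> * \<tau> y * \<tau> (u * z) + \<alpha> (y * g) z))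
        = (\<lambda>y z. \<kappa> * \<tau> y * \<tau> ((c *\<^sub>C u) * z) + c * \<alpha> (y * g) z)"
      by (intro ext) (simp add: distrib_left mult_scaleC_left tr_scaleC)
    then show ?case using pair_span.scale[OF scale.IH, of c] by (simp add: mult_scaleC_right)
  qed
  have "(u, \<alpha>) \<in> pair_span N" if "(u, \<alpha>) \<in> diff_graph Gen" for u \<alpha>
    using that by induction (simp_all add: one span_left pair_span.add pair_span.scale)
  then show ?thesis by auto
qed

abbreviation partial_generators ::
    "('i \<Rightarrow> 'a) \<Rightarrow> 'i set \<Rightarrow> 'i \<Rightarrow> 'a set \<Rightarrow> ('a \<times> complex) set" where
  "partial_generators x I i B \<equiv> (\<lambda>j. (x j, if j = i then 1 else 0)) ` I \<union> (\<lambda>b. (b, 0)) ` B"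

text \<open>The free difference quotient, with respect to \<open>x i\<close>, of the word \<open>nc_word x b w\<close>: the sum, over
  the occurrences of \<open>x i\<close>, of the part before it \<open>\<otimes>\<close> the part after it. At \<open>y = z = 1\<close> it is the
  right side of the conjugate relation.\<close>

definition nc_diff :: "('i \<Rightarrow> 'a) \<Rightarrow> 'i \<Rightarrow> 'a \<Rightarrow> ('i \<times> 'a) list \<Rightarrow> 'a \<Rightarrow> 'a \<Rightarrow> complex" where
  "nc_diff x i b w y z =
     (\<Sum>m<length w. if fst (w ! m) = i
        then \<tau> (y * nc_word x b (take m w)) * \<tau> (nc_word x (snd (w ! m)) (drop (Suc m) w) * z) else 0)"

lemma nc_diff_one:
  "nc_diff x i b w 1 1 = (\<Sum>m<length w. if fst (w ! m) = i
     then \<tau> (nc_word x b (take m w)) * \<tau> (nc_word x (snd (w ! m)) (drop (Suc m) w)) else 0)"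
  by (simp add: nc_diff_def cong: if_cong)

lemma nc_diff_Cons:
  "nc_diff x i b ((j, c) # w) y z
    = (if j = i then \<tau> (y * b) * \<tau> (nc_word x c w * z) else 0) + nc_diff x i c w (y * b * x j) z"
  unfolding nc_diff_def
  by (simp add: sum.lessThan_Suc_shift nc_word_Cons mult.assoc if_distrib cong: if_cong del: sum.lessThan_Suc)

text \<open>The conjugate relation is imposed on words only. It extends to the whole graph, because a
  generator times a word is a word, and the difference quotients match.\<close>

lemma diff_graph_eval_words:
  fixes F :: "'a \<Rightarrow> complex"
  assumes B: "unital_star_subalgebra B"
    and F: "\<And>b w. b \<in> B \<Longrightarrow> w \<in> lists (I \<times> B) \<Longrightarrow> F (nc_word x b w) = nc_diff x i b w 1 1"
    and F_linear: "\<And>x y. F (x + y) = F x + F y" "\<And>c x. F (c *\<^sub>C x) = c * F x"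
    and u: "(u, \<alpha>) \<in> diff_graph (partial_generators x I i B)"
  shows "F u = \<alpha> 1 1"
proof -
  let ?Gen = "partial_generators x I i B"
  define N where "N = {(nc_word x b w, nc_diff x i b w) |b w. b \<in> B \<and> w \<in> lists (I \<times> B)}"
  note B' = unital_star_subalgebraD[OF B]
  have in_N: "(nc_word x b w, nc_diff x i b w) \<in> N" if "b \<in> B" "w \<in> lists (I \<times> B)" for b w
    using that by (auto simp: N_def)
  have "diff_graph ?Gen \<subseteq> pair_span N"
  proof (rule diff_graph_subset_pair_span)
    show "(1, \<lambda>y z. 0) \<in> pair_span N"
      using pair_span.base[OF in_N[OF B'(1), of "[]"]] by (simp add: nc_diff_def[abs_def])
  next
    fix g \<kappa> u \<alpha>
    assume g: "(g, \<kappa>) \<in> ?Gen" and "(u, \<alpha>) \<in> N"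
    then obtain b w where bw: "b \<in> B" "w \<in> lists (I \<times> B)" and u: "u = nc_word x b w" "\<alpha> = nc_diff x i b w"
      by (auto simp: N_def)
    from g consider j where "j \<in> I" "g = x j" "\<kappa> = (if j = i then 1 else 0)" | "g \<in> B" "\<kappa> = 0"
      by auto
    then show "(g * u, \<lambda>y z. \<kappa> * \<tau> y * \<tau> (u * z) + \<alpha> (y * g) z) \<in> pair_span N"
    proof cases
      case 1
      then have "(nc_word x 1 ((j, b) # w), nc_diff x i 1 ((j, b) # w)) \<in> N"
        using bw B'(1) by (intro in_N) auto
      moreover have "nc_diff x i 1 ((j, b) # w) = (\<lambda>y z. \<kappa> * \<tau> y * \<tau> (u * z) + \<alpha> (y * g) z)"
        using 1 u by (intro ext) (simp add: nc_diff_Cons)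
      ultimately show ?thesis using 1 u by (auto intro: pair_span.base simp: nc_word_Cons)
    next
      case 2
      then have "(nc_word x (g * b) w, nc_diff x i (g * b) w) \<in> N"
        using bw B'(3) by (intro in_N) auto
      moreover have "nc_diff x i (g * b) w = (\<lambda>y z. \<alpha> (y * g) z)"
        using u by (intro ext) (simp add: nc_diff_def nc_word_mult mult.assoc cong: if_cong)
      ultimately show ?thesis using 2 u by (auto intro: pair_span.base simp: nc_word_mult)
    qed
  qed
  with u have "(u, \<alpha>) \<in> pair_span N" by blast
  moreover have "F v = \<beta> 1 1" if "(v, \<beta>) \<in> N" for v \<beta>
    using that F by (auto simp only: N_def mem_Collect_eq prod.inject)
  ultimately show ?thesis
    using pair_span_eval[of u \<alpha> N F] F_linear by blast
qed

lemma nc_word_diff_graph: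
  assumes b: "\<And>b. b \<in> B \<Longrightarrow> (b, \<lambda>y z. 0) \<in> diff_graph Gen"
    and x: "\<And>j. j \<in> I \<Longrightarrow> (x j, \<lambda>y z. if j = i then \<tau> y * \<tau> z else 0) \<in> diff_graph Gen"
    and "b \<in> B" "w \<in> lists (I \<times> B)"
  shows "(nc_word x b w, nc_diff x i b w) \<in> diff_graph Gen"
  using assms(4,3)
proof (induction w arbitrary: b)
  case Nil
  then show ?case using assms(1) by (simp add: nc_diff_def[abs_def])
next
  case (Cons jc w)
  obtain j c where jc: "jc = (j, c)" by fastforce
  have j: "j \<in> I" "c \<in> B" using Cons jc by auto
  have "nc_diff x i b ((j, c) # w)
    = (\<lambda>y z. 0 + ((if j = i then \<tau> (y * b) * \<tau> (nc_word x c w * z) else 0) + nc_diff x i c w (y * b * x j) z))"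
    by (intro ext) (simp add: nc_diff_Cons)
  then show ?case
    using diff_graph_mult[OF assms(1)[OF Cons.prems] diff_graph_mult[OF x[OF j(1)] Cons.IH[OF j(2)]]]
    by (simp add: jc nc_word_Cons)
qed

end


section \<open>Freeness of complementary subfamilies\<close>

inductive_set complex_span :: "'a::cstar_algebra set \<Rightarrow> 'a set" for N where
  zero: "0 \<in> complex_span N"
| base: "u \<in> N \<Longrightarrow> u \<in> complex_span N"
| add: "u \<in> complex_span N \<Longrightarrow> v \<in> complex_span N \<Longrightarrow> u + v \<in> complex_span N"
| scale: "u \<in> complex_span N \<Longrightarrow> c *\<^sub>C u \<in> complex_span N"

context tracial_state
begin

definition centered_alternating :: "('i \<Rightarrow> 'a set) \<Rightarrow> 'i set \<Rightarrow> ('i \<times> 'a) list \<Rightarrow> bool" where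
  "centered_alternating A I ws \<longleftrightarrow>
     distinct_adj (map fst ws) \<and> (\<forall>(i, x) \<in> set ws. i \<in> I \<and> x \<in> A i \<and> \<tau> x = 0)"

lemma centered_alternating_Nil [simp]: "centered_alternating A I []"
  by (simp add: centered_alternating_def)

lemma centered_alternating_Cons:
  "centered_alternating A I ((i, x) # ws) \<longleftrightarrow>
     i \<in> I \<and> x \<in> A i \<and> \<tau> x = 0 \<and> (ws \<noteq> [] \<longrightarrow> fst (hd ws) \<noteq> i) \<and> centered_alternating A I ws"
  by (cases ws) (auto simp: centered_alternating_def)

lemma centered_alternating_append:
  "centered_alternating A I (ws @ vs) \<longleftrightarrow>
     centered_alternating A I ws \<and> centered_alternating A I vs \<and>
     (ws = [] \<or> vs = [] \<or> fst (last ws) \<noteq> fst (hd vs))"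
  by (auto simp: centered_alternating_def distinct_adj_append_iff last_map hd_map)

lemma free_familyD:
  assumes "free_family \<tau> I X" "ws \<noteq> []" "centered_alternating (\<lambda>i. star_hull (X i)) I ws"
  shows "\<tau> (prod_list (map snd ws)) = 0"
  using assms unfolding free_family_def centered_alternating_def by blast

lemma centered_member:
  assumes "unital_star_subalgebra M" "x \<in> M"
  shows "x - \<tau> x *\<^sub>C 1 \<in> M" "\<tau> (x - \<tau> x *\<^sub>C 1) = 0"
  using unital_star_subalgebraD[OF assms(1)] assms(2) by (simp_all add: tr_diff tr_scaleC)

text \<open>A factor times a centered alternating word is, after centering the factor or its product with
  the first letter, a combination of such words. Hence these words and \<open>1\<close> span the algebra, and
  freeness makes the coefficient of \<open>1\<close> the trace.\<close>

lemma free_family_span: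
  fixes X :: "'i \<Rightarrow> 'a set"
  assumes free: "free_family \<tau> I X" and J: "J \<subseteq> I"
    and e: "e \<in> star_hull (\<Union>j\<in>J. X j)" "\<tau> e = 0"
  shows "e \<in> complex_span {prod_list (map snd ws) |ws. ws \<noteq> [] \<and>
    centered_alternating (\<lambda>i. star_hull (X i)) J ws}"
proof -
  let ?A = "\<lambda>i. star_hull (X i)"
  define U where "U = {prod_list (map snd ws) |ws. ws \<noteq> [] \<and> centered_alternating ?A J ws}"
  note A = star_hull_subalgebra[of "X _"]
  have U: "prod_list (map snd ws) \<in> U" if "ws \<noteq> []" "centered_alternating ?A J ws" for ws
    using that by (auto simp: U_def)
  have U_null: "\<tau> u = 0" if u: "u \<in> U" for u
  proof -
    obtain ws where ws: "u = prod_list (map snd ws)" "ws \<noteq> []" "centered_alternating ?A J ws"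
      using u unfolding U_def by blast
    then have "centered_alternating ?A I ws" using J by (auto simp: centered_alternating_def)
    then show ?thesis using free_familyD[OF free ws(2)] ws(1) by simp
  qed
  let ?V = "complex_span (insert 1 U)"
  have word: "prod_list (map snd ws) \<in> ?V" if "centered_alternating ?A J ws" for ws
    using U[of ws] that by (cases "ws = []") (auto intro: complex_span.base)
  have cons: "x * prod_list (map snd ws) \<in> ?V"
    if x: "x \<in> ?A j" "j \<in> J" and ws: "centered_alternating ?A J ws" "ws \<noteq> [] \<Longrightarrow> fst (hd ws) \<noteq> j" for x j ws
  proof -
    have "centered_alternating ?A J ((j, x - \<tau> x *\<^sub>C 1) # ws)"
      using x ws centered_member[OF A x(1)] by (simp add: centered_alternating_Cons)
    from word[OF this] have "(x - \<tau> x *\<^sub>C 1) * prod_list (map snd ws) \<in> ?V" by simp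
    then have "(x - \<tau> x *\<^sub>C 1) * prod_list (map snd ws) + \<tau> x *\<^sub>C prod_list (map snd ws) \<in> ?V"
      using word[OF ws(1)] by (intro complex_span.add complex_span.scale)
    then show ?thesis by (simp add: left_diff_distrib mult_scaleC_left)
  qed
  have left: "x * v \<in> ?V" if v: "v \<in> ?V" and x: "x \<in> ?A j" "j \<in> J" for x j v
    using v
  proof induction
    case (base u)
    then consider "u = 1" | ws where "u = prod_list (map snd ws)" "ws \<noteq> []" "centered_alternating ?A J ws"
      by (auto simp: U_def)
    then show ?case
    proof cases
      case 1
      then show ?thesis using cons[OF x, of "[]"] by simp
    next
      case (2 ws)
      then obtain i y vs where ws: "ws = (i, y) # vs" by (cases ws) auto
      show ?thesis
      proof (cases "i = j")
        case True
        then have "x * y \<in> ?A j"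
          using 2(3) x(1) unital_star_subalgebraD(3)[OF A] by (simp add: ws centered_alternating_Cons)
        then show ?thesis
          using cons[of "x * y" j vs] 2 x(2) True by (auto simp: ws centered_alternating_Cons mult.assoc)
      next
        case False
        then show ?thesis using cons[OF x 2(3)] 2(1) ws by simp
      qed
    qed
  qed (simp_all add: distrib_left mult_scaleC_right complex_span.intros)
  have "star_hull (\<Union>j\<in>J. X j) \<subseteq> ?V"
  proof (rule star_hull_subset_left)
    fix x v assume "x \<in> (\<Union>j\<in>J. X j)" and v: "v \<in> ?V"
    then obtain j where "j \<in> J" "x \<in> X j" by blast
    then have j: "j \<in> J" "x \<in> ?A j" "star x \<in> ?A j"
      using hull_subset[of "X j"] unital_star_subalgebraD(5)[OF A[of j]] by auto
    show "x * v \<in> ?V" "star x * v \<in> ?V"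
      using left[OF v j(2,1)] left[OF v j(3,1)] .
  qed (auto intro: complex_span.intros)
  then have "e \<in> ?V" using e(1) by blast
  then have "e - \<tau> e *\<^sub>C 1 \<in> complex_span U"
  proof induction
    case (base u)
    then show ?case using U_null by (auto intro: complex_span.intros)
  next
    case (add u v)
    then show ?case using complex_span.add[OF add.IH] by (simp add: tr_add scaleC_add_left algebra_simps)
  next
    case (scale u c)
    then show ?case
      using complex_span.scale[OF scale.IH, of c] by (simp add: tr_scaleC scaleC_diff_right scaleC_scaleC)
  qed (simp add: complex_span.zero)
  then show ?thesis using e(2) by (simp add: U_def)
qed

text \<open>Associativity of freeness. In an alternating centered product of elements of the two
  algebras, each factor from the second one is expanded into alternating words that avoid the index
  \<open>i0\<close>; the result still alternates.\<close>

lemma free_family_complement: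
  fixes X :: "'i \<Rightarrow> 'a set"
  assumes free: "free_family \<tau> I X" and i0: "i0 \<in> I"
  shows "free_family \<tau> UNIV (\<lambda>s. if s then star_hull (\<Union>j\<in>I - {i0}. X j) else star_hull (X i0))"
proof -
  let ?A = "\<lambda>i. star_hull (X i)"
  define E where "E = star_hull (\<Union>j\<in>I - {i0}. X j)"
  let ?AE = "\<lambda>s. if s then E else ?A i0"
  define U where "U = {prod_list (map snd ws) |ws. ws \<noteq> [] \<and> centered_alternating ?A (I - {i0}) ws}"
  have span: "e \<in> complex_span U" if "e \<in> E" "\<tau> e = 0" for e
    using free_family_span[OF free, of "I - {i0}" e] that by (simp add: U_def E_def)
  \<comment> \<open>The factors are read from left to right; \<open>pre\<close> is the part already expanded into the finer
    alternation, and it ends in the algebra that does not follow.\<close>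
  have null: "\<tau> (prod_list (map snd pre) * prod_list (map snd ws)) = 0"
    if "pre \<noteq> [] \<or> ws \<noteq> []" "centered_alternating ?A I pre" "centered_alternating ?AE UNIV ws"
      "pre \<noteq> [] \<Longrightarrow> ws \<noteq> [] \<Longrightarrow> (fst (last pre) = i0) = fst (hd ws)" for pre ws
    using that
  proof (induction ws arbitrary: pre)
    case Nil
    then show ?case using free_familyD[OF free, of pre] by simp
  next
    case (Cons sx ws)
    obtain s x where sx: "sx = (s, x)" by fastforce
    have x: "x \<in> ?AE s" "\<tau> x = 0" "ws \<noteq> [] \<Longrightarrow> fst (hd ws) \<noteq> s" "centered_alternating ?AE UNIV ws"
      using Cons.prems(3) by (auto simp: sx centered_alternating_Cons)
    show ?case
    proof (cases s)
      case True
      have "\<tau> (prod_list (map snd pre) * (e * prod_list (map snd ws))) = 0" if "e \<in> complex_span U" for e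
        using that
      proof induction
        case (base u)
        then obtain us where us: "u = prod_list (map snd us)" "us \<noteq> []"
          "centered_alternating ?A (I - {i0}) us" by (auto simp: U_def)
        have "fst p \<noteq> i0" if "p \<in> set us" for p
          using us(3) that by (cases p) (auto simp: centered_alternating_def)
        then have us_I: "centered_alternating ?A I us" "fst (hd us) \<noteq> i0" "fst (last us) \<noteq> i0"
          using us(2,3) by (auto simp: centered_alternating_def)
        have "\<tau> (prod_list (map snd (pre @ us)) * prod_list (map snd ws)) = 0"
        proof (rule Cons.IH)
          show "centered_alternating ?A I (pre @ us)"
            using Cons.prems(2,4) us_I True by (auto simp: centered_alternating_append sx)
        qed (use us us_I x True in auto)
        then show ?case by (simp add: us mult.assoc)
      qed (simp_all add: distrib_left distrib_right tr_add tr_scaleC mult_scaleC_left mult_scaleC_right)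
      then show ?thesis using span x True by (simp add: sx)
    next
      case False
      have "\<tau> (prod_list (map snd (pre @ [(i0, x)])) * prod_list (map snd ws)) = 0"
      proof (rule Cons.IH)
        show "centered_alternating ?A I (pre @ [(i0, x)])"
          using Cons.prems(2,4) x False i0 by (auto simp: centered_alternating_append centered_alternating_Cons sx)
      qed (use x False in auto)
      then show ?thesis by (simp add: sx mult.assoc)
    qed
  qed
  have AE: "star_hull (?AE s) = ?AE s" for s
    by (simp add: E_def star_hull_self star_hull_subalgebra)
  show ?thesis
    unfolding free_family_def E_def[symmetric] AE
    using null[of "[]"] by (auto simp: centered_alternating_def)
qed


section \<open>Free extension of the conjugate relation\<close>

text \<open>Normal forms \<open>d\<^sub>0 e\<^sub>1 d\<^sub>1 \<cdots> e\<^sub>k d\<^sub>k\<close> with \<open>d\<^sub>0, e\<^sub>1, \<dots>, d\<^bsub>k-1\<^esub>, e\<^sub>k\<close> centered, paired with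
  their difference quotients for the derivation that vanishes on \<open>E\<close>. The last factor \<open>d\<^sub>k\<close> is
  arbitrary. These are the products that a centered element of \<open>E\<close> may precede.\<close>

inductive_set centered_tail ::
    "('a \<times> complex) set \<Rightarrow> 'a set \<Rightarrow> ('a \<times> ('a \<Rightarrow> 'a \<Rightarrow> complex)) set" for Gen E where
  base: "(d, \<delta>) \<in> diff_graph Gen \<Longrightarrow> (d, \<delta>) \<in> centered_tail Gen E"
| step: "(d, \<delta>) \<in> diff_graph Gen \<Longrightarrow> \<tau> d = 0 \<Longrightarrow> e \<in> E \<Longrightarrow> \<tau> e = 0 \<Longrightarrow> (w, \<beta>) \<in> centered_tail Gen E \<Longrightarrow>
    (d * (e * w), \<lambda>y z. \<delta> y (e * (w * z)) + \<beta> (y * (d * e)) z) \<in> centered_tail Gen E"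

lemma centered_tail_biadditive:
  assumes "(w, \<beta>) \<in> centered_tail Gen E"
  shows "biadditive \<beta>"
  using assms
proof induction
  case (base d \<delta>)
  then show ?case by (rule diff_graph_biadditive)
next
  case (step d \<delta> e w \<beta>)
  then show ?case
    using diff_graph_biadditive[OF step.hyps(1)]
    by (simp add: biadditive_def distrib_left distrib_right mult_scaleC_left mult_scaleC_right algebra_simps)
qed

text \<open>A functional \<open>F\<close> given by a vector of \<open>D\<close> that satisfies the conjugate relation on \<open>D\<close>
  satisfies it on the algebra generated by \<open>D\<close> and a free subalgebra \<open>E\<close> on which the derivation is
  zero. By traciality and freeness, \<open>F\<close> annihilates \<open>d\<^sub>0 e\<^sub>1 d\<^sub>1 \<cdots> e\<^sub>k d\<^sub>k\<close> with \<open>k > 0\<close> and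
  centered \<open>e\<^sub>1, d\<^sub>1, \<dots>, d\<^bsub>k-1\<^esub>, e\<^sub>k\<close>. Cutting such a product inside some \<open>d\<^sub>m\<close> leaves on one side
  an alternating centered product between two elements of \<open>D\<close>, of trace zero, so \<open>\<tau> \<otimes> \<tau>\<close> of the
  difference quotient is zero too. These products and \<open>D\<close> span the whole algebra.\<close>

lemma free_extension_of_conjugate_relation:
  assumes D: "unital_star_subalgebra D" "fst ` Gen \<subseteq> D" and E: "unital_star_subalgebra E"
    and free: "free_family \<tau> UNIV (\<lambda>s. if s then E else D)"
    and X: "range X \<subseteq> D" "\<And>w. (\<lambda>k. \<tau> (X k * w)) \<longlonglongrightarrow> F w"
    and F_D: "\<And>u \<alpha>. (u, \<alpha>) \<in> diff_graph Gen \<Longrightarrow> F u = \<alpha> 1 1"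
    and F_linear: "\<And>x y. F (x + y) = F x + F y" "\<And>c x. F (c *\<^sub>C x) = c * F x"
    and u: "(u, \<alpha>) \<in> diff_graph (Gen \<union> (\<lambda>e. (e, 0)) ` E)"
  shows "F u = \<alpha> 1 1"
proof -
  let ?AE = "\<lambda>s. if s then E else D"
  let ?T = "centered_tail Gen E"
  note D' = unital_star_subalgebraD[OF D(1)] and E' = unital_star_subalgebraD[OF E]
  have AE: "(\<lambda>s. star_hull (?AE s)) = ?AE"
    using D(1) E by (auto simp: star_hull_self)
  have alternating_null: "\<tau> (prod_list (map snd ws)) = 0" if "centered_alternating ?AE UNIV ws" "ws \<noteq> []" for ws
    using free_familyD[OF free that(2)] that(1) unfolding AE by blast

  \<comment> \<open>\<open>e\<^sub>1 d\<^sub>1 \<cdots> d\<^bsub>m-1\<^esub> e\<^sub>m\<close>, the part of a normal form between two elements of \<open>D\<close>.\<close>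
  define bridge where "bridge ws \<longleftrightarrow> ws \<noteq> [] \<and> centered_alternating ?AE UNIV ws \<and>
    fst (hd ws) \<and> fst (last ws)" for ws
  have bridge_null: "\<tau> (p * prod_list (map snd ws)) = 0" if ws: "bridge ws" and p: "p \<in> D" for p ws
  proof -
    have "centered_alternating ?AE UNIV ((False, p - \<tau> p *\<^sub>C 1) # ws)"
      using ws centered_member[OF D(1) p] by (simp add: bridge_def centered_alternating_Cons)
    from alternating_null[OF this] have "\<tau> ((p - \<tau> p *\<^sub>C 1) * prod_list (map snd ws)) = 0" by simp
    moreover have "\<tau> (prod_list (map snd ws)) = 0"
      using ws by (intro alternating_null) (simp_all add: bridge_def)
    ultimately show ?thesis by (simp add: left_diff_distrib mult_scaleC_left tr_diff tr_scaleC)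
  qed
  have bridge_null': "\<tau> (d * prod_list (map snd ws) * p) = 0" if "bridge ws" "p \<in> D" "d \<in> D" for d p ws
    using bridge_null[OF that(1) D'(3)[OF that(2,3)]] tr_commute[of "d * prod_list (map snd ws)" p]
    by (simp add: mult.assoc)
  have tail_shape: "\<exists>ws d. bridge ws \<and> d \<in> D \<and> e * w = prod_list (map snd ws) * d"
    if "(w, \<beta>) \<in> ?T" "e \<in> E" "\<tau> e = 0" for w \<beta> e
    using that
  proof (induction arbitrary: e)
    case (base d \<delta>)
    then have "bridge [(True, e)]" "d \<in> D"
      using diff_graph_fst[OF _ D] by (auto simp: bridge_def centered_alternating_Cons)
    then show ?case by (intro exI[of _ "[(True, e)]"] exI[of _ d]) simp
  next
    case (step d \<delta> e' w \<beta>)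
    obtain ws d' where ws: "bridge ws" "d' \<in> D" "e' * w = prod_list (map snd ws) * d'"
      using step.IH[OF step.hyps(3,4)] by blast
    have "bridge ((True, e) # (False, d) # ws)"
      using ws(1) step.prems step.hyps(2) diff_graph_fst[OF step.hyps(1) D]
      by (simp add: bridge_def centered_alternating_Cons)
    moreover have "e * (d * (e' * w)) = prod_list (map snd ((True, e) # (False, d) # ws)) * d'"
      by (simp add: ws(3) mult.assoc)
    ultimately show ?case using ws(2) by blast
  qed
  have tail_null: "\<tau> (p * (e * w)) = 0" if w: "(w, \<beta>) \<in> ?T" "e \<in> E" "\<tau> e = 0" and p: "p \<in> D" for p w \<beta> e
  proof -
    obtain ws d where "bridge ws" "d \<in> D" "e * w = prod_list (map snd ws) * d"
      using tail_shape[OF w] by blast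
    then show ?thesis using bridge_null'[of ws d p] p by (simp add: mult.assoc)
  qed
  have tail_diff_null: "\<beta> (d * prod_list (map snd ws)) 1 = 0"
    if "(w, \<beta>) \<in> ?T" "bridge ws" "d \<in> D" for w \<beta> d ws
    using that
  proof (induction arbitrary: ws)
    case (base d' \<delta>)
    then show ?case using diff_graph_null_left[OF base.hyps D] bridge_null' by blast
  next
    case (step d' \<delta> e w \<beta>)
    have "\<delta> (d * prod_list (map snd ws)) (e * (w * 1)) = 0"
      using tail_null[OF step.hyps(5,3,4)] by (intro diff_graph_null_right[OF step.hyps(1) D]) simp
    moreover have "bridge (ws @ [(False, d'), (True, e)])"
      using step.prems(1) step.hyps(2-4) diff_graph_fst[OF step.hyps(1) D]
      by (simp add: bridge_def centered_alternating_append centered_alternating_Cons)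
    from step.IH[OF this step.prems(2)]
    have "\<beta> (d * prod_list (map snd ws) * (d' * e)) 1 = 0" by (simp add: mult.assoc)
    ultimately show ?case by simp
  qed

  define N where "N = diff_graph Gen \<union>
    {(d * (e * w), \<lambda>y z. \<delta> y (e * (w * z)) + \<beta> (y * (d * e)) z) |d \<delta> e w \<beta>.
      (d, \<delta>) \<in> diff_graph Gen \<and> e \<in> E \<and> \<tau> e = 0 \<and> (w, \<beta>) \<in> ?T}"
  have N_D: "(d, \<delta>) \<in> pair_span N" if "(d, \<delta>) \<in> diff_graph Gen" for d \<delta>
    using that by (auto simp: N_def intro: pair_span.base)
  have N_step: "(d * (e * w), \<lambda>y z. \<delta> y (e * (w * z)) + \<beta> (y * (d * e)) z) \<in> pair_span N"
    if "(d, \<delta>) \<in> diff_graph Gen" "e \<in> E" "\<tau> e = 0" "(w, \<beta>) \<in> ?T" for d \<delta> e w \<beta>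
    using that by (intro pair_span.base) (unfold N_def, blast)
  have N_step1: "(e * w, \<lambda>y z. \<beta> (y * e) z) \<in> pair_span N"
    if "e \<in> E" "\<tau> e = 0" "(w, \<beta>) \<in> ?T" for e w \<beta>
    using N_step[OF diff_graph.one that] by simp
  have N_tail: "(w, \<beta>) \<in> pair_span N" if "(w, \<beta>) \<in> ?T" for w \<beta>
    using that by cases (auto intro: N_D N_step)

  have eval_N: "F v = \<beta> 1 1" if "(v, \<beta>) \<in> N" for v \<beta>
  proof (cases "(v, \<beta>) \<in> diff_graph Gen")
    case True
    then show ?thesis by (rule F_D)
  next
    case False
    with that obtain d \<delta> e w \<gamma> where v: "v = d * (e * w)" "\<beta> = (\<lambda>y z. \<delta> y (e * (w * z)) + \<gamma> (y * (d * e)) z)"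
      and d: "(d, \<delta>) \<in> diff_graph Gen" and e: "e \<in> E" "\<tau> e = 0" and w: "(w, \<gamma>) \<in> ?T"
      unfolding N_def by blast
    have "\<tau> (X k * v) = 0" for k
      using tail_null[OF w e, of "X k * d"] D'(3)[of "X k" d] X(1) diff_graph_fst[OF d D]
      by (auto simp: v(1) mult.assoc)
    then have "F v = 0" using X(2)[of v] by (simp add: LIMSEQ_const_iff)
    moreover have "\<delta> 1 (e * (w * 1)) = 0"
      using tail_null[OF w e] by (intro diff_graph_null_right[OF d D]) simp
    moreover have "bridge [(True, e)]" using e by (simp add: bridge_def centered_alternating_Cons)
    from tail_diff_null[OF w this diff_graph_fst[OF d D]] have "\<gamma> (1 * (d * e)) 1 = 0" by simp
    ultimately show ?thesis by (simp add: v(2))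
  qed

  have "diff_graph (Gen \<union> (\<lambda>e. (e, 0)) ` E) \<subseteq> pair_span N"
  proof (rule diff_graph_subset_pair_span)
    show "(1, \<lambda>y z. 0) \<in> pair_span N" by (intro N_D diff_graph.one)
  next
    fix g \<kappa> v \<alpha>
    assume g: "(g, \<kappa>) \<in> Gen \<union> (\<lambda>e. (e, 0)) ` E" and v: "(v, \<alpha>) \<in> N"
    consider (D) "(v, \<alpha>) \<in> diff_graph Gen"
      | (step) d \<delta> e w \<beta> where "v = d * (e * w)" "\<alpha> = (\<lambda>y z. \<delta> y (e * (w * z)) + \<beta> (y * (d * e)) z)"
        "(d, \<delta>) \<in> diff_graph Gen" "e \<in> E" "\<tau> e = 0" "(w, \<beta>) \<in> ?T"
      using v unfolding N_def by blast
    note cases_v = this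
    show "(g * v, \<lambda>y z. \<kappa> * \<tau> y * \<tau> (v * z) + \<alpha> (y * g) z) \<in> pair_span N"
    proof (cases "(g, \<kappa>) \<in> Gen")
      case True
      from cases_v show ?thesis
      proof cases
        case D
        then show ?thesis by (intro N_D diff_graph.gen True)
      next
        case (step d \<delta> e w \<beta>)
        show ?thesis
          using N_step[OF diff_graph.gen[OF True step(3)] step(4-6)]
          by (simp add: step(1,2) mult.assoc add.assoc)
      qed
    next
      case False
      with g have \<kappa>: "\<kappa> = 0" and gE: "g \<in> E" by auto
      define g' where "g' = g - \<tau> g *\<^sub>C 1"
      have g': "g' \<in> E" "\<tau> g' = 0" "g = g' + \<tau> g *\<^sub>C 1"
        using centered_member[OF E gE] by (simp_all add: g'_def)
      from cases_v show ?thesis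
      proof cases
        case D
        note bi = biadditiveD[OF diff_graph_biadditive[OF D]]
        have "(g' * v + \<tau> g *\<^sub>C v, \<lambda>y z. \<alpha> (y * g') z + \<tau> g * \<alpha> y z) \<in> pair_span N"
          by (intro pair_span.add pair_span.scale N_step1 g' centered_tail.base D N_D)
        moreover have "g' * v + \<tau> g *\<^sub>C v = g * v"
          by (subst (2) g'(3)) (simp add: distrib_right mult_scaleC_left)
        moreover have "\<alpha> (y * g') z + \<tau> g * \<alpha> y z = \<alpha> (y * g) z" for y z
          by (subst (2) g'(3)) (simp add: distrib_left mult_scaleC_right bi)
        ultimately show ?thesis by (simp add: \<kappa>)
      next
        case (step d \<delta> e w \<beta>)
        \<comment> \<open>Centering \<open>g\<close>, then \<open>d\<close>, then the product \<open>g' e\<close> that meets when \<open>d\<close> is replaced by its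
          trace, gives
          \<open>g d e w = \<tau>(g) d e w + g' d' e w + \<tau>(d) (f w + \<tau>(g' e) w)\<close>.\<close>
        note bi_\<delta> = biadditiveD[OF diff_graph_biadditive[OF step(3)]]
        note bi_\<beta> = biadditiveD[OF centered_tail_biadditive[OF step(6)]]
        define d' where "d' = d + (- \<tau> d) *\<^sub>C 1"
        have d': "(d', \<delta>) \<in> diff_graph Gen" "\<tau> d' = 0" "d = d' + \<tau> d *\<^sub>C 1"
          using diff_graph_center[OF step(3)] scaleC_add_left[of "- \<tau> d" "\<tau> d" "1::'a"]
          by (simp_all add: d'_def tr_add tr_scaleC add.assoc)
        define f where "f = g' * e - \<tau> (g' * e) *\<^sub>C 1"
        have f: "f \<in> E" "\<tau> f = 0" "g' * e = f + \<tau> (g' * e) *\<^sub>C 1"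
          using centered_member[OF E E'(3)[OF g'(1) step(4)]] by (simp_all add: f_def)
        have "(\<tau> g *\<^sub>C v + (g' * (d' * (e * w)) + \<tau> d *\<^sub>C (f * w + \<tau> (g' * e) *\<^sub>C w)),
            \<lambda>y z. \<tau> g * \<alpha> y z + ((\<delta> (y * g') (e * (w * z)) + \<beta> (y * g' * (d' * e)) z) +
              \<tau> d * (\<beta> (y * f) z + \<tau> (g' * e) * \<beta> y z))) \<in> pair_span N"
          by (intro pair_span.add pair_span.scale pair_span.base[OF v] N_tail[OF step(6)]
              N_step1[OF f(1,2) step(6)]
              N_step1[OF g'(1,2) centered_tail.step[OF d'(1,2) step(4-6)]])
        moreover have g_d: "g * (d * x) = \<tau> g *\<^sub>C (d * x) + (g' * (d' * x) + \<tau> d *\<^sub>C (g' * x))" for x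
        proof -
          have "g * (d * x) = g' * (d * x) + \<tau> g *\<^sub>C (d * x)"
            by (subst g'(3)) (simp add: distrib_right mult_scaleC_left)
          also have "g' * (d * x) = g' * (d' * x) + \<tau> d *\<^sub>C (g' * x)"
            by (subst d'(3)) (simp add: distrib_right distrib_left mult_scaleC_left mult_scaleC_right)
          finally show ?thesis by (simp add: algebra_simps)
        qed
        have "\<tau> g *\<^sub>C v + (g' * (d' * (e * w)) + \<tau> d *\<^sub>C (f * w + \<tau> (g' * e) *\<^sub>C w)) = g * v"
        proof -
          have "g' * (e * w) = f * w + \<tau> (g' * e) *\<^sub>C w"
            using arg_cong[OF f(3), of "\<lambda>u. u * w"] by (simp add: distrib_right mult_scaleC_left mult.assoc)
          then show ?thesis by (simp add: step(1) g_d)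
        qed
        moreover have "\<tau> g * \<alpha> y z + ((\<delta> (y * g') (e * (w * z)) + \<beta> (y * g' * (d' * e)) z) +
              \<tau> d * (\<beta> (y * f) z + \<tau> (g' * e) * \<beta> y z)) = \<alpha> (y * g) z" for y z
        proof -
          have "y * g = y * g' + \<tau> g *\<^sub>C y"
            by (subst g'(3)) (simp add: distrib_left mult_scaleC_right)
          then have "\<delta> (y * g) (e * (w * z)) = \<delta> (y * g') (e * (w * z)) + \<tau> g * \<delta> y (e * (w * z))"
            by (simp add: bi_\<delta>)
          moreover have "y * g * (d * e)
              = \<tau> g *\<^sub>C (y * (d * e)) + (y * g' * (d' * e) + \<tau> d *\<^sub>C (y * f + \<tau> (g' * e) *\<^sub>C y))"
          proof -
            have "y * (g' * e) = y * f + \<tau> (g' * e) *\<^sub>C y"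
              by (subst f(3)) (simp add: distrib_left mult_scaleC_right)
            then show ?thesis
              using arg_cong[OF g_d[of e], of "\<lambda>u. y * u"]
              by (simp add: distrib_left mult_scaleC_right mult.assoc)
          qed
          then have "\<beta> (y * g * (d * e)) z = \<tau> g * \<beta> (y * (d * e)) z + (\<beta> (y * g' * (d' * e)) z +
              \<tau> d * (\<beta> (y * f) z + \<tau> (g' * e) * \<beta> y z))"
            by (simp only: bi_\<beta>)
          ultimately show ?thesis by (simp add: step(2) algebra_simps)
        qed
        ultimately show ?thesis by (simp add: \<kappa>)
      qed
    qed
  qed
  with u have "(u, \<alpha>) \<in> pair_span N" by blast
  then show ?thesis
    using pair_span_eval[of u \<alpha> N F] eval_N F_linear by blast
qed

end


section \<open>Moments of the semicircle law\<close>

definition semicircle_moment :: "nat \<Rightarrow> real" where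
  "semicircle_moment k = (LBINT x:{-2..2}. x ^ k * (sqrt (4 - x\<^sup>2) / (2 * pi)))"

lemma semicircle_moment_integral:
  "((\<lambda>x. x ^ k * (sqrt (4 - x\<^sup>2) / (2 * pi))) has_integral semicircle_moment k) {-2..2}"
proof -
  have "set_integrable lborel {-2..2} (\<lambda>x::real. x ^ k * (sqrt (4 - x\<^sup>2) / (2 * pi)))"
    by (intro borel_integrable_atLeastAtMost' continuous_intros) auto
  note eq = set_borel_integral_eq_integral[OF this]
  show ?thesis
    unfolding semicircle_moment_def eq(2) by (rule integrable_integral[OF eq(1)])
qed

lemma DERIV_semicircle:
  fixes x :: real
  assumes "-2 < x" "x < 2"
  shows "0 < 4 - x\<^sup>2" "((\<lambda>x. sqrt (4 - x\<^sup>2)) has_real_derivative - x / sqrt (4 - x\<^sup>2)) (at x)"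
proof -
  have "0 < (2 - x) * (2 + x)" using assms by (intro mult_pos_pos) auto
  then show "0 < 4 - x\<^sup>2" by (simp add: algebra_simps power2_eq_square)
  then show "((\<lambda>x. sqrt (4 - x\<^sup>2)) has_real_derivative - x / sqrt (4 - x\<^sup>2)) (at x)"
    by (auto intro!: derivative_eq_intros simp: field_simps)
qed

lemma semicircle_moment_0: "semicircle_moment 0 = 1"
proof -
  let ?G = "\<lambda>x::real. (x * sqrt (4 - x\<^sup>2) / 2 + 2 * arcsin (x / 2)) / (2 * pi)"
  have derivative: "((\<lambda>x. (x * \<sigma> x / 2 + 2 * A x) / (2 * pi)) has_real_derivative
      ((s + x * \<sigma>') / 2 + 2 * A') / (2 * pi)) (at x)"
    if "(\<sigma> has_real_derivative \<sigma>') (at x)" "(A has_real_derivative A') (at x)" "\<sigma> x = s" for \<sigma> A \<sigma>' A' x s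
    using that by (auto intro!: derivative_eq_intros simp: field_simps)
  have int: "((\<lambda>x. sqrt (4 - x\<^sup>2) / (2 * pi)) has_integral (?G 2 - ?G (-2))) {-2..2}"
  proof (rule fundamental_theorem_of_calculus_interior)
    show "continuous_on {-2..2} ?G"
      by (intro continuous_intros) auto
    fix x :: real assume "x \<in> {-2<..<2}"
    then have x: "-2 < x" "x < 2" by auto
    define s where "s = sqrt (4 - x\<^sup>2)"
    have s: "s > 0" "s * s = 4 - x * x"
      using DERIV_semicircle(1)[OF x] by (simp_all add: s_def power2_eq_square)
    have "sqrt (1 - (x / 2)\<^sup>2) = sqrt ((4 - x\<^sup>2) / 4)"
      by (simp add: power_divide diff_divide_distrib)
    also have "\<dots> = s / 2" by (simp add: s_def real_sqrt_divide)
    finally have sqrt: "sqrt (1 - (x / 2)\<^sup>2) = s / 2" .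
    have "DERIV arcsin (x / 2) :> inverse (s / 2)"
      unfolding sqrt[symmetric] using x by (intro DERIV_arcsin) auto
    then have arcsin: "((\<lambda>x. arcsin (x / 2)) has_real_derivative inverse (s / 2) * (1 / 2)) (at x)"
      by (rule DERIV_chain2) (auto intro!: derivative_eq_intros)
    have "(?G has_real_derivative ((s + x * (- x / s)) / 2 + 2 * (inverse (s / 2) * (1 / 2))) / (2 * pi)) (at x)"
      by (rule derivative) (rule DERIV_semicircle(2)[OF x, folded s_def], rule arcsin, simp add: s_def)
    moreover have "(s + x * (- x / s)) / 2 + 2 * (inverse (s / 2) * (1 / 2)) = s"
      using s by (simp add: field_simps)
    ultimately show "(?G has_vector_derivative sqrt (4 - x\<^sup>2) / (2 * pi)) (at x)"
      by (simp add: s_def has_real_derivative_iff_has_vector_derivative)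
  qed simp
  have "?G 2 - ?G (-2) = 1" by (simp add: arcsin_minus)
  moreover have "((\<lambda>x. sqrt (4 - x\<^sup>2) / (2 * pi)) has_integral semicircle_moment 0) {-2..2}"
    using semicircle_moment_integral[of 0] by simp
  ultimately show ?thesis using has_integral_unique[OF int] by fastforce
qed

text \<open>The derivative of \<open>x\<^bsup>k+1\<^esup> (4 - x\<^sup>2)\<^bsup>3/2\<^esup>\<close> integrates to zero.\<close>

lemma semicircle_moment_step:
  "(real k + 4) * semicircle_moment (k + 2) = 4 * (real k + 1) * semicircle_moment k"
proof -
  let ?f = "\<lambda>k (x::real). x ^ k * (sqrt (4 - x\<^sup>2) / (2 * pi))"
  let ?H = "\<lambda>x::real. x ^ (k + 1) * sqrt (4 - x\<^sup>2) ^ 3 / (2 * pi)"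
  have derivative: "((\<lambda>x. x ^ (k + 1) * \<sigma> x ^ 3 / (2 * pi)) has_real_derivative
      ((real k + 1) * x ^ k * s ^ 3 + x ^ (k + 1) * (3 * s\<^sup>2 * \<sigma>')) / (2 * pi)) (at x)"
    if "(\<sigma> has_real_derivative \<sigma>') (at x)" "\<sigma> x = s" for \<sigma> \<sigma>' x s
  proof -
    have "((\<lambda>x. x ^ (k + 1)) has_real_derivative (real k + 1) * x ^ k) (at x)"
      using DERIV_pow[of "k + 1" x] by (simp add: add.commute)
    moreover have "((\<lambda>x. \<sigma> x ^ 3) has_real_derivative 3 * s\<^sup>2 * \<sigma>') (at x)"
      using that by (auto intro!: derivative_eq_intros)
    ultimately have "((\<lambda>x. x ^ (k + 1) * \<sigma> x ^ 3 / (2 * pi)) has_real_derivative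
        ((real k + 1) * x ^ k * \<sigma> x ^ 3 + 3 * s\<^sup>2 * \<sigma>' * x ^ (k + 1)) / (2 * pi)) (at x)"
      by (intro DERIV_cdivide DERIV_mult)
    then show ?thesis by (simp only: that(2) mult.commute)
  qed
  have "((\<lambda>x. 4 * (real k + 1) * ?f k x - (real k + 4) * ?f (k + 2) x) has_integral (?H 2 - ?H (-2))) {-2..2}"
  proof (rule fundamental_theorem_of_calculus_interior)
    show "continuous_on {-2..2} ?H"
      by (intro continuous_intros) auto
    fix x :: real assume "x \<in> {-2<..<2}"
    then have x: "-2 < x" "x < 2" by auto
    define s where "s = sqrt (4 - x\<^sup>2)"
    have s: "s > 0" "s * s = 4 - x * x"
      using DERIV_semicircle(1)[OF x] by (simp_all add: s_def power2_eq_square)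
    have "(?H has_real_derivative
        ((real k + 1) * x ^ k * s ^ 3 + x ^ (k + 1) * (3 * s\<^sup>2 * (- x / s))) / (2 * pi)) (at x)"
      by (rule derivative) (rule DERIV_semicircle(2)[OF x, folded s_def], simp add: s_def)
    moreover have s3: "s ^ 3 = (4 - x * x) * s" "3 * s\<^sup>2 * (- x / s) = - 3 * x * s"
      using s by (simp add: power3_eq_cube) (use s(1) in \<open>simp add: power2_eq_square\<close>)
    have "((real k + 1) * x ^ k * s ^ 3 + x ^ (k + 1) * (3 * s\<^sup>2 * (- x / s))) / (2 * pi)
        = 4 * (real k + 1) * ?f k x - (real k + 4) * ?f (k + 2) x"
      unfolding s_def[symmetric] s3 by (simp add: field_simps)
    ultimately show "(?H has_vector_derivative
        4 * (real k + 1) * ?f k x - (real k + 4) * ?f (k + 2) x) (at x)"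
      by (simp add: has_real_derivative_iff_has_vector_derivative)
  qed simp
  moreover have "((\<lambda>x. 4 * (real k + 1) * ?f k x - (real k + 4) * ?f (k + 2) x) has_integral
      4 * (real k + 1) * semicircle_moment k - (real k + 4) * semicircle_moment (k + 2)) {-2..2}"
    by (intro has_integral_diff has_integral_mult_right semicircle_moment_integral)
  ultimately have "4 * (real k + 1) * semicircle_moment k - (real k + 4) * semicircle_moment (k + 2)
      = ?H 2 - ?H (-2)"
    by (rule has_integral_unique[rotated])
  then show ?thesis by simp
qed

lemma semicircle_moment_1: "semicircle_moment 1 = 0"
proof -
  let ?H = "\<lambda>x::real. - (sqrt (4 - x\<^sup>2) ^ 3) / 3 / (2 * pi)"
  have derivative: "((\<lambda>x. - (\<sigma> x ^ 3) / 3 / (2 * pi)) has_real_derivative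
      - (3 * (\<sigma> x)\<^sup>2 * \<sigma>') / 3 / (2 * pi)) (at x)"
    if "(\<sigma> has_real_derivative \<sigma>') (at x)" for \<sigma> \<sigma>' x
    using that by (auto intro!: derivative_eq_intros)
  have "((\<lambda>x. x ^ 1 * (sqrt (4 - x\<^sup>2) / (2 * pi))) has_integral (?H 2 - ?H (-2))) {-2..2}"
  proof (rule fundamental_theorem_of_calculus_interior)
    show "continuous_on {-2..2} ?H"
      by (intro continuous_intros) auto
    fix x :: real assume "x \<in> {-2<..<2}"
    then have x: "-2 < x" "x < 2" by auto
    have "(?H has_real_derivative - (3 * (sqrt (4 - x\<^sup>2))\<^sup>2 * (- x / sqrt (4 - x\<^sup>2))) / 3 / (2 * pi)) (at x)"
      by (rule derivative) (rule DERIV_semicircle(2)[OF x])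
    moreover have "- (3 * (sqrt (4 - x\<^sup>2))\<^sup>2 * (- x / sqrt (4 - x\<^sup>2))) / 3 / (2 * pi)
        = x ^ 1 * (sqrt (4 - x\<^sup>2) / (2 * pi))"
      using DERIV_semicircle(1)[OF x] by (simp add: power2_eq_square field_simps)
    ultimately show "(?H has_vector_derivative x ^ 1 * (sqrt (4 - x\<^sup>2) / (2 * pi))) (at x)"
      by (simp add: has_real_derivative_iff_has_vector_derivative)
  qed simp
  from has_integral_unique[OF this semicircle_moment_integral] show ?thesis by simp
qed

lemma semicircle_moment_odd: "odd k \<Longrightarrow> semicircle_moment k = 0"
proof (induction k rule: less_induct)
  case (less k)
  show ?case
  proof (cases "k = 1")
    case False
    then obtain j where k: "k = j + 2" using less.prems
      by (metis One_nat_def add_2_eq_Suc' even_zero not0_implies_Suc)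
    then show ?thesis using less.IH[of j] less.prems semicircle_moment_step[of j] by simp
  qed (use semicircle_moment_1 in simp)
qed

text \<open>The even moments are the Catalan numbers, here read off the binomial series of \<open>\<surd>(1 - 4z)\<close>.\<close>

lemma semicircle_moment_even:
  "semicircle_moment (2 * k) = - (1/2) * (-4) ^ (k + 1) * ((1/2) gchoose (k + 1))"
proof (induction k)
  case 0
  then show ?case by (simp add: semicircle_moment_0)
next
  case (Suc k)
  let ?b = "(1/2::real) gchoose (k + 1)" and ?b' = "(1/2::real) gchoose (k + 2)"
  have b': "?b' * (real k + 2) = ?b * (1/2 - (real k + 1))"
    using gbinomial_absorption[of "k + 1" "1/2::real"] gbinomial_absorb_comp[of "1/2::real" "k + 1"]
    by (simp add: algebra_simps)
  have "(real k + 2) * semicircle_moment (2 * Suc k) = (4 * real k + 2) * semicircle_moment (2 * k)"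
    using semicircle_moment_step[of "2 * k"] by (simp add: algebra_simps)
  also have "\<dots> = - (1/2) * (-4) ^ (k + 2) * (?b * (1/2 - (real k + 1)))"
    unfolding Suc.IH by (simp add: algebra_simps)
  also have "\<dots> = (real k + 2) * (- (1/2) * (-4) ^ (k + 2) * ?b')"
    unfolding b'[symmetric] by simp
  finally have "semicircle_moment (2 * Suc k) = - (1/2) * (-4) ^ (k + 2) * ?b'"
    by (subst (asm) mult_cancel_left) auto
  moreover have "Suc k + 1 = k + 2" by simp
  ultimately show ?case by metis
qed

text \<open>The recurrence \<open>C\<^bsub>n+1\<^esub> = \<Sum> C\<^sub>i C\<^bsub>n-i\<^esub>\<close> of the Catalan numbers holds because the square of
  \<open>\<surd>(1 - 4z)\<close> has no terms of degree at least two.\<close>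

lemma semicircle_moment_even_convolution:
  "semicircle_moment (2 * n + 2) = (\<Sum>i\<le>n. semicircle_moment (2 * i) * semicircle_moment (2 * (n - i)))"
proof -
  let ?b = "\<lambda>k. (1/2::real) gchoose k"
  have "fps_nth (fps_binomial (1/2) * fps_binomial (1/2)) (n + 2) = fps_nth (fps_binomial (1::real)) (n + 2)"
    by (simp only: fps_binomial_add_mult[symmetric]) simp
  moreover have "(1::real) gchoose (n + 2) = 0"
    using binomial_gbinomial[of 1 "n + 2", where 'a = real] by simp
  ultimately have square: "(\<Sum>i\<le>n + 2. ?b i * ?b (n + 2 - i)) = 0"
    by (simp add: fps_mult_nth atLeast0AtMost)
  have shift: "(\<Sum>i\<le>n + 2. f i) = f 0 + (\<Sum>i\<le>n. f (Suc i)) + f (n + 2)" for f :: "nat \<Rightarrow> real"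
    by (simp only: numeral_2_eq_2 add_Suc_right add_0_right sum.atMost_Suc[of f "Suc n"]
        sum.atMost_Suc_shift[of f n])
  have sum: "(\<Sum>i\<le>n. ?b (i + 1) * ?b (n + 1 - i)) = - 2 * ?b (n + 2)"
    using square unfolding shift by simp
  have "(\<Sum>i\<le>n. semicircle_moment (2 * i) * semicircle_moment (2 * (n - i)))
      = (\<Sum>i\<le>n. (1/4) * (-4) ^ (n + 2) * (?b (i + 1) * ?b (n + 1 - i)))"
  proof (rule sum.cong)
    fix i assume "i \<in> {..n}"
    then have i: "i \<le> n" by simp
    then have "(i + 1) + (n + 1 - i) = n + 2" by simp
    then have p: "(-4::real) ^ (i + 1) * (-4) ^ (n + 1 - i) = (-4) ^ (n + 2)"
      by (metis power_add)
    have "(- (1/2) * p * b) * (- (1/2) * q * c) = (1/4) * (p * q) * (b * c)" for p q b c :: real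
      by simp
    moreover have "n - i + 1 = n + 1 - i" using i by simp
    ultimately show "semicircle_moment (2 * i) * semicircle_moment (2 * (n - i))
        = (1/4) * (-4) ^ (n + 2) * (?b (i + 1) * ?b (n + 1 - i))"
      by (simp only: semicircle_moment_even p)
  qed simp
  also have "\<dots> = (1/4) * (-4) ^ (n + 2) * (- 2 * ?b (n + 2))"
    by (simp only: sum_distrib_left[symmetric] sum)
  also have "\<dots> = semicircle_moment (2 * (n + 1))"
    unfolding semicircle_moment_even by simp
  finally show ?thesis by simp
qed

text \<open>The Schwinger--Dyson equation of the semicircle law: a semicircular variable is its own
  conjugate variable.\<close>

lemma semicircle_moment_Suc:
  "semicircle_moment (Suc k) = (\<Sum>m<k. semicircle_moment m * semicircle_moment (k - 1 - m))"
proof (cases "even k")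
  case True
  have "semicircle_moment m * semicircle_moment (k - 1 - m) = 0" if "m < k" for m
    using that True by (cases "even m") (auto intro!: semicircle_moment_odd)
  then have "(\<Sum>m<k. semicircle_moment m * semicircle_moment (k - 1 - m)) = 0"
    by (intro sum.neutral) blast
  then show ?thesis using True by (simp only: semicircle_moment_odd even_Suc not_not)
next
  case False
  then obtain n where k: "k = 2 * n + 1" by (auto elim: oddE)
  have "(\<Sum>m<k. semicircle_moment m * semicircle_moment (k - 1 - m))
      = (\<Sum>m\<in>(\<lambda>i. 2 * i) ` {..n}. semicircle_moment m * semicircle_moment (k - 1 - m))"
  proof (rule sum.mono_neutral_right)
    show "\<forall>m\<in>{..<k} - (\<lambda>i. 2 * i) ` {..n}. semicircle_moment m * semicircle_moment (k - 1 - m) = 0"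
    proof
      fix m assume m: "m \<in> {..<k} - (\<lambda>i. 2 * i) ` {..n}"
      have "odd m"
      proof
        assume "even m"
        then obtain i where "m = 2 * i" by (auto elim: evenE)
        with m show False by (auto simp: k)
      qed
      then show "semicircle_moment m * semicircle_moment (k - 1 - m) = 0"
        by (simp add: semicircle_moment_odd)
    qed
  qed (auto simp: k)
  also have "\<dots> = (\<Sum>i\<le>n. semicircle_moment (2 * i) * semicircle_moment (2 * (n - i)))"
    by (subst sum.reindex) (auto simp: inj_on_def k right_diff_distrib' intro!: sum.cong)
  also have "\<dots> = semicircle_moment (Suc k)"
    using semicircle_moment_even_convolution[of n] by (simp add: k)
  finally show ?thesis ..
qed


section \<open>Score vectors\<close>

context tracial_state
begin

text \<open>A vector satisfying the conjugate relation for the index \<open>i\<close>. It need not lie in the closure of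
  the algebra generated by \<open>x\<close> and \<open>B\<close>: its orthogonal projection to that closure is the conjugate
  variable, so that the square of its norm bounds a summand of the free Fisher information.\<close>

definition score_vector :: "'i set \<Rightarrow> ('i \<Rightarrow> 'a) \<Rightarrow> 'a set \<Rightarrow> 'i \<Rightarrow> (nat \<Rightarrow> 'a) \<Rightarrow> bool" where
  "score_vector I x B i X \<longleftrightarrow> X \<in> L2_cauchy \<tau> \<and>
     (\<forall>b\<in>B. \<forall>w\<in>lists (I \<times> B). (\<lambda>k. \<tau> (X k * nc_word x b w)) \<longlonglongrightarrow> nc_diff x i b w 1 1)"

lemma vector_functional:
  assumes X: "X \<in> L2_cauchy \<tau>" and r: "(\<lambda>k. phi_norm \<tau> (X k)) \<longlonglongrightarrow> r"
  obtains F where "\<And>w. (\<lambda>k. \<tau> (X k * w)) \<longlonglongrightarrow> F w" "\<And>u v. F (u + v) = F u + F v"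
    "\<And>c u. F (c *\<^sub>C u) = c * F u" "\<And>w. cmod (F w) \<le> r * phi_norm \<tau> w"
proof -
  define F where "F w = lim (\<lambda>k. \<tau> (X k * w))" for w
  have F: "(\<lambda>k. \<tau> (X k * w)) \<longlonglongrightarrow> F w" for w
    using convergent_tr_mult[OF X] by (simp add: F_def convergent_LIMSEQ_iff)
  have "F (u + v) = F u + F v" for u v
    using tendsto_add[OF F[of u] F[of v]] F[of "u + v"] LIMSEQ_unique
    by (fastforce simp: distrib_left tr_add)
  moreover have "F (c *\<^sub>C u) = c * F u" for c u
    using tendsto_mult_left[OF F[of u], of c] F[of "c *\<^sub>C u"] LIMSEQ_unique
    by (fastforce simp: mult_scaleC_right tr_scaleC)
  moreover have "cmod (F w) \<le> r * phi_norm \<tau> w" for w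
    using Cauchy_Schwarz
    by (intro LIMSEQ_le[OF tendsto_norm[OF F[of w]] tendsto_mult_right[OF r, of "phi_norm \<tau> w"]]) blast
  ultimately show ?thesis using that F by blast
qed

lemma words_span_star_hull:
  assumes B: "unital_star_subalgebra B" and x: "\<And>i. i \<in> I \<Longrightarrow> star (x i) = x i"
  shows "star_hull (x ` I \<union> B) \<subseteq> complex_span {nc_word x b w |b w. b \<in> B \<and> w \<in> lists (I \<times> B)}"
proof -
  note B' = unital_star_subalgebraD[OF B]
  define W where "W = {nc_word x b w |b w. b \<in> B \<and> w \<in> lists (I \<times> B)}"
  have W: "nc_word x b w \<in> W" if "b \<in> B" "w \<in> lists (I \<times> B)" for b w
    using that unfolding W_def by blast
  have letter: "g * u \<in> W" if g: "g \<in> x ` I \<union> B" and u_W: "u \<in> W" for g u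
  proof -
    obtain b w where u: "u = nc_word x b w" "b \<in> B" "w \<in> lists (I \<times> B)" using u_W unfolding W_def by blast
    from g consider i where "i \<in> I" "g = x i" | "g \<in> B" by blast
    then show ?thesis
    proof cases
      case (1 i)
      then show ?thesis using W[OF B'(1), of "(i, b) # w"] u by (simp add: nc_word_Cons)
    next
      case 2
      then show ?thesis using W[OF B'(3)[OF 2 u(2)] u(3)] u(1) by (simp add: nc_word_mult)
    qed
  qed
  have left: "g * v \<in> complex_span W" if "v \<in> complex_span W" "g \<in> x ` I \<union> B" for g v
    using that(1)
  proof induction
    case (base u)
    then show ?case by (intro complex_span.base letter[OF that(2)])
  qed (simp_all add: distrib_left mult_scaleC_right complex_span.intros)
  have "star_hull (x ` I \<union> B) \<subseteq> complex_span W"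
  proof (rule star_hull_subset_left)
    show "1 \<in> complex_span W"
      using W[OF B'(1), of "[]"] by (simp add: complex_span.base)
    fix g v assume g: "g \<in> x ` I \<union> B" and v: "v \<in> complex_span W"
    show "g * v \<in> complex_span W" using left[OF v g] .
    have "star g \<in> x ` I \<union> B" using g x B'(5) by auto
    then show "star g * v \<in> complex_span W" by (rule left[OF v])
  qed (rule complex_span.intros; assumption)+
  then show ?thesis by (simp only: W_def)
qed

lemma score_vector_norm_le:
  assumes B: "unital_star_subalgebra B" and x: "\<And>i. i \<in> I \<Longrightarrow> star (x i) = x i"
    and Y: "score_vector I x B i Y" "range Y \<subseteq> star_hull (x ` I \<union> B)" "(\<lambda>k. phi_norm \<tau> (Y k)) \<longlonglongrightarrow> s"
    and X: "score_vector I x B i X" "(\<lambda>k. phi_norm \<tau> (X k)) \<longlonglongrightarrow> r"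
  shows "s \<le> r"
proof -
  have X': "X \<in> L2_cauchy \<tau>" and Y': "Y \<in> L2_cauchy \<tau>"
    using X(1) Y(1) by (simp_all add: score_vector_def)
  obtain F where F: "\<And>w. (\<lambda>k. \<tau> (X k * w)) \<longlonglongrightarrow> F w" "\<And>u v. F (u + v) = F u + F v"
    "\<And>c u. F (c *\<^sub>C u) = c * F u" "\<And>w. cmod (F w) \<le> r * phi_norm \<tau> w"
    by (rule vector_functional[OF X' X(2)]) (rule that)
  obtain G where G: "\<And>w. (\<lambda>k. \<tau> (Y k * w)) \<longlonglongrightarrow> G w" "\<And>u v. G (u + v) = G u + G v"
    "\<And>c u. G (c *\<^sub>C u) = c * G u" "\<And>w. cmod (G w) \<le> s * phi_norm \<tau> w"
    by (rule vector_functional[OF Y' Y(3)]) (rule that)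
  have zero: "F 0 = 0" "G 0 = 0" using F(3)[of 0 0] G(3)[of 0 0] by simp_all
  define W where "W = {nc_word x b w |b w. b \<in> B \<and> w \<in> lists (I \<times> B)}"
  have word: "F u = G u" if u_W: "u \<in> W" for u
  proof -
    obtain b w where u: "u = nc_word x b w" "b \<in> B" "w \<in> lists (I \<times> B)" using u_W unfolding W_def by blast
    have "F u = nc_diff x i b w 1 1"
      using X(1) u by (intro LIMSEQ_unique[OF F(1)[of u]]) (simp only: score_vector_def)
    moreover have "G u = nc_diff x i b w 1 1"
      using Y(1) u by (intro LIMSEQ_unique[OF G(1)[of u]]) (simp only: score_vector_def)
    ultimately show ?thesis by simp
  qed
  have eq: "F u = G u" if "u \<in> complex_span W" for u
    using that
  proof induction
    case (base u)
    then show ?case by (rule word)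
  qed (simp_all add: zero F(2,3) G(2,3))
  have "0 \<le> r" using X(2) by (intro LIMSEQ_le_const) auto
  then show ?thesis
  proof (rule representing_norm_le[OF Y(2) Y' Y(3)])
    fix w assume "w \<in> star_hull (x ` I \<union> B)"
    then have "F w = G w" using words_span_star_hull[of B I x] B x by (intro eq) (unfold W_def, blast)
    then show "(\<lambda>k. \<tau> (Y k * w)) \<longlonglongrightarrow> F w \<and> cmod (F w) \<le> r * phi_norm \<tau> w"
      using G(1) F(4) by metis
  qed (rule star_hull_subalgebra)
qed

lemma nc_word_in_star_hull:
  assumes "b \<in> B" "w \<in> lists (I \<times> B)"
  shows "nc_word x b w \<in> star_hull (x ` I \<union> B)"
  using assms(2,1)
proof (induction w arbitrary: b)
  case Nil
  then show ?case by (simp add: hull_inc)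
next
  case (Cons jc w)
  obtain j c where jc: "jc = (j, c)" "j \<in> I" "c \<in> B" using Cons by (cases jc) auto
  note H = unital_star_subalgebraD[OF star_hull_subalgebra[of "x ` I \<union> B"]]
  have "b \<in> star_hull (x ` I \<union> B)" "x j \<in> star_hull (x ` I \<union> B)"
    using Cons.prems jc by (auto intro: hull_inc)
  then show ?case using Cons.IH[OF jc(3)] H(3) by (simp add: jc(1) nc_word_Cons)
qed

lemma score_vector_projection:
  assumes B: "unital_star_subalgebra B" and x: "\<And>i. i \<in> I \<Longrightarrow> star (x i) = x i"
    and X: "score_vector I x B i X" "(\<lambda>k. phi_norm \<tau> (X k)) \<longlonglongrightarrow> r"
  obtains Y s where "score_vector I x B i Y" "range Y \<subseteq> star_hull (x ` I \<union> B)"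
    "(\<lambda>k. phi_norm \<tau> (Y k)) \<longlonglongrightarrow> s" "s \<le> r"
proof -
  have X': "X \<in> L2_cauchy \<tau>" using X(1) by (simp add: score_vector_def)
  obtain F where F: "\<And>w. (\<lambda>k. \<tau> (X k * w)) \<longlonglongrightarrow> F w" "\<And>u v. F (u + v) = F u + F v"
    "\<And>c u. F (c *\<^sub>C u) = c * F u" "\<And>w. cmod (F w) \<le> r * phi_norm \<tau> w"
    by (rule vector_functional[OF X' X(2)]) (rule that)
  obtain Y where Y: "range Y \<subseteq> star_hull (x ` I \<union> B)" "Y \<in> L2_cauchy \<tau>"
    "\<And>w. w \<in> star_hull (x ` I \<union> B) \<Longrightarrow> (\<lambda>k. \<tau> (Y k * w)) \<longlonglongrightarrow> F w"
    using Riesz_representation_subalgebra[OF star_hull_subalgebra[of "x ` I \<union> B"] F(2-4)] by blast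
  have "score_vector I x B i Y"
    unfolding score_vector_def
  proof (intro conjI ballI Y(2))
    fix b w assume bw: "b \<in> B" "w \<in> lists (I \<times> B)"
    then have "F (nc_word x b w) = nc_diff x i b w 1 1"
      using X(1) by (intro LIMSEQ_unique[OF F(1)]) (simp only: score_vector_def)
    then show "(\<lambda>k. \<tau> (Y k * nc_word x b w)) \<longlonglongrightarrow> nc_diff x i b w 1 1"
      using Y(3)[OF nc_word_in_star_hull[OF bw]] by simp
  qed
  moreover obtain s where s: "(\<lambda>k. phi_norm \<tau> (Y k)) \<longlonglongrightarrow> s"
    using convergent_phi_norm[OF Y(2)] by (auto simp: convergent_def)
  ultimately show ?thesis
    using that Y(1) score_vector_norm_le[OF B x _ Y(1) s X] by blast
qed

lemma conjugate_system_score_vector: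
  assumes "conjugate_system \<tau> I x B \<xi>" "i \<in> I"
  obtains Y where "score_vector I x B i Y" "range Y \<subseteq> star_hull (x ` I \<union> B)"
    "(\<lambda>k. phi_norm \<tau> (Y k)) \<longlonglongrightarrow> L2_norm \<tau> (\<xi> i)"
proof -
  have \<xi>: "\<xi> i \<in> L2 \<tau>" and "\<exists>Y\<in>\<xi> i. range Y \<subseteq> star_hull (x ` I \<union> B)"
    using assms by (auto simp: conjugate_system_def L2_generated_def)
  then obtain Y where Y: "Y \<in> \<xi> i" "range Y \<subseteq> star_hull (x ` I \<union> B)" by blast
  have "score_vector I x B i Y"
    unfolding score_vector_def
  proof (intro conjI ballI L2_members(1)[OF \<xi> Y(1) Y(1)])
    fix b w assume bw: "b \<in> B" "w \<in> lists (I \<times> B)"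
    then have "L2_apply \<tau> (\<xi> i) (nc_word x b w) = nc_diff x i b w 1 1"
      using assms unfolding conjugate_system_def nc_diff_one by blast
    then show "(\<lambda>k. \<tau> (Y k * nc_word x b w)) \<longlonglongrightarrow> nc_diff x i b w 1 1"
      using L2_apply_tendsto[OF \<xi> Y(1), of "nc_word x b w"] by simp
  qed
  then show ?thesis using that Y(2) L2_norm_tendsto[OF \<xi> Y(1)] by blast
qed

lemma conjugate_system_exists:
  assumes x: "\<And>i. i \<in> I \<Longrightarrow> star (x i) = x i"
    and Y: "\<And>i. i \<in> I \<Longrightarrow> score_vector I x B i (Y i) \<and> range (Y i) \<subseteq> star_hull (x ` I \<union> B)"
  shows "\<exists>\<xi>. conjugate_system \<tau> I x B \<xi>"
proof (intro exI)
  let ?\<xi> = "\<lambda>i. L2_rel \<tau> `` {Y i}"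
  have vector: "?\<xi> i \<in> L2 \<tau>" "Y i \<in> ?\<xi> i" if "i \<in> I" for i
    using Y[OF that] L2_class[of "Y i"] by (simp_all only: score_vector_def)
  show "conjugate_system \<tau> I x B ?\<xi>"
    unfolding conjugate_system_def
  proof (intro conjI ballI)
    show "self_adjoint_family I x" using x by (auto simp: self_adjoint_family_def)
    fix i assume i: "i \<in> I"
    show "?\<xi> i \<in> L2_generated \<tau> (x ` I \<union> B)"
      using vector[OF i] Y[OF i] unfolding L2_generated_def by blast
    fix b w assume bw: "b \<in> B" "w \<in> lists (I \<times> B)"
    have "(\<lambda>k. \<tau> (Y i k * nc_word x b w)) \<longlonglongrightarrow> nc_diff x i b w 1 1"
      using Y[OF i] bw by (simp only: score_vector_def)
    then have "L2_apply \<tau> (?\<xi> i) (nc_word x b w) = nc_diff x i b w 1 1"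
      using L2_apply_tendsto[OF vector[OF i], of "nc_word x b w"] LIMSEQ_unique by blast
    then show "L2_apply \<tau> (?\<xi> i) (nc_word x b w) =
        (\<Sum>m<length w. if fst (w ! m) = i
           then \<tau> (nc_word x b (take m w)) * \<tau> (nc_word x (snd (w ! m)) (drop (Suc m) w)) else 0)"
      by (simp only: nc_diff_one)
  qed
qed

text \<open>The projections of the score vectors form a conjugate system. The bound applies to whichever
  system enters the definition, because all of them have the same pairings with the generated
  algebra.\<close>

lemma free_fisher_le:
  assumes "finite I" and B: "unital_star_subalgebra B" and x: "\<And>i. i \<in> I \<Longrightarrow> star (x i) = x i"
    and X: "\<And>i. i \<in> I \<Longrightarrow> score_vector I x B i (X i)" "\<And>i. i \<in> I \<Longrightarrow> (\<lambda>k. phi_norm \<tau> (X i k)) \<longlonglongrightarrow> r i"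
  shows "free_fisher \<tau> I x B \<le> ennreal (\<Sum>i\<in>I. (r i)\<^sup>2)"
proof -
  have "\<exists>Y. score_vector I x B i Y \<and> range Y \<subseteq> star_hull (x ` I \<union> B)" if "i \<in> I" for i
    using score_vector_projection[OF B x X(1)[OF that] X(2)[OF that]] by metis
  then obtain Y where "\<And>i. i \<in> I \<Longrightarrow> score_vector I x B i (Y i) \<and> range (Y i) \<subseteq> star_hull (x ` I \<union> B)"
    by metis
  then have ex: "\<exists>\<xi>. conjugate_system \<tau> I x B \<xi>" using x by (intro conjugate_system_exists)
  define \<xi> where "\<xi> = (SOME \<xi>. conjugate_system \<tau> I x B \<xi>)"
  have \<xi>: "conjugate_system \<tau> I x B \<xi>" unfolding \<xi>_def using ex by (rule someI_ex)
  have "(L2_norm \<tau> (\<xi> i))\<^sup>2 \<le> (r i)\<^sup>2" if i: "i \<in> I" for i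
  proof -
    obtain Z where Z: "score_vector I x B i Z" "range Z \<subseteq> star_hull (x ` I \<union> B)"
      "(\<lambda>k. phi_norm \<tau> (Z k)) \<longlonglongrightarrow> L2_norm \<tau> (\<xi> i)"
      using conjugate_system_score_vector[OF \<xi> i] by blast
    have "0 \<le> L2_norm \<tau> (\<xi> i)" using Z(3) by (intro LIMSEQ_le_const) auto
    then show ?thesis
      using score_vector_norm_le[OF B x Z X(1)[OF i] X(2)[OF i]] by (simp add: power_mono)
  qed
  then have "(\<Sum>i\<in>I. ennreal ((L2_norm \<tau> (\<xi> i))\<^sup>2)) \<le> (\<Sum>i\<in>I. ennreal ((r i)\<^sup>2))"
    by (intro sum_mono ennreal_leI)
  then show ?thesis
    using ex \<open>finite I\<close> by (simp add: free_fisher_def \<xi>_def sum_ennreal)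
qed

text \<open>The free Cramer--Rao inequality: the conjugate variable of \<open>x i\<close> pairs to \<open>1\<close> with \<open>x i\<close>.\<close>

lemma free_fisher_ge:
  assumes "finite I" and B: "1 \<in> B" and x: "\<And>i. i \<in> I \<Longrightarrow> star (x i) = x i"
    and c: "c > 0" "\<And>i. i \<in> I \<Longrightarrow> Re (\<tau> (x i * x i)) \<le> c"
  shows "ennreal (real (card I) / c) \<le> free_fisher \<tau> I x B"
proof (cases "\<exists>\<xi>. conjugate_system \<tau> I x B \<xi>")
  case True
  define \<xi> where "\<xi> = (SOME \<xi>. conjugate_system \<tau> I x B \<xi>)"
  have \<xi>: "conjugate_system \<tau> I x B \<xi>" unfolding \<xi>_def using True by (rule someI_ex)
  have "1 / c \<le> (L2_norm \<tau> (\<xi> i))\<^sup>2" if i: "i \<in> I" for i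
  proof -
    obtain Z where Z: "score_vector I x B i Z" "range Z \<subseteq> star_hull (x ` I \<union> B)"
      "(\<lambda>k. phi_norm \<tau> (Z k)) \<longlonglongrightarrow> L2_norm \<tau> (\<xi> i)"
      using conjugate_system_score_vector[OF \<xi> i] by blast
    have "(\<lambda>k. \<tau> (Z k * nc_word x 1 [(i, 1)])) \<longlonglongrightarrow> nc_diff x i 1 [(i, 1)] 1 1"
      using Z(1) B i unfolding score_vector_def by auto
    then have "(\<lambda>k. \<tau> (Z k * x i)) \<longlonglongrightarrow> 1"
      by (simp add: nc_word_Cons nc_diff_def)
    then have "cmod 1 \<le> L2_norm \<tau> (\<xi> i) * phi_norm \<tau> (x i)"
      using Cauchy_Schwarz
      by (intro LIMSEQ_le[OF tendsto_norm tendsto_mult_right[OF Z(3), of "phi_norm \<tau> (x i)"]]) blast+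
    then have "1 \<le> (L2_norm \<tau> (\<xi> i) * phi_norm \<tau> (x i))\<^sup>2"
      by (intro one_le_power) simp
    also have "\<dots> = (L2_norm \<tau> (\<xi> i))\<^sup>2 * Re (\<tau> (x i * x i))"
      by (simp add: power_mult_distrib phi_norm_square x i)
    also have "\<dots> \<le> (L2_norm \<tau> (\<xi> i))\<^sup>2 * c"
      using c(2)[OF i] by (intro mult_left_mono) auto
    finally show ?thesis using c(1) by (simp add: pos_divide_le_eq)
  qed
  then have "(\<Sum>i\<in>I. 1 / c) \<le> (\<Sum>i\<in>I. (L2_norm \<tau> (\<xi> i))\<^sup>2)"
    by (intro sum_mono)
  then have "ennreal (real (card I) / c) \<le> ennreal (\<Sum>i\<in>I. (L2_norm \<tau> (\<xi> i))\<^sup>2)"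
    by (intro ennreal_leI) simp
  then show ?thesis
    using True \<open>finite I\<close> by (simp add: free_fisher_def \<xi>_def sum_ennreal)
qed (simp add: free_fisher_def)


section \<open>Semicircular perturbations\<close>

lemma diff_graph_null_generator: "(e, 0) \<in> Gen \<Longrightarrow> (e, \<lambda>y z. 0) \<in> diff_graph Gen"
  using diff_graph_generator[of e 0 Gen] by simp

text \<open>A score vector of \<open>x\<close> remains one after a free perturbation: this is the free extension of the
  conjugate relation by the algebra of \<open>S\<close>, evaluated on words in \<open>x i + s S\<^sub>i\<close>.\<close>

lemma score_vector_free_perturbation:
  assumes B: "unital_star_subalgebra B"
    and S: "free_semicirculars \<tau> n S (x ` {1..n} \<union> B)"
    and Y: "score_vector {1..n} x B i Y" "range Y \<subseteq> star_hull (x ` {1..n} \<union> B)"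
  shows "score_vector {1..n} (\<lambda>j. x j + s *\<^sub>R S j) B i Y"
proof -
  let ?y = "\<lambda>j. x j + s *\<^sub>R S j" and ?Gen = "partial_generators x {1..n} i B"
  define A where "A = (\<lambda>j. if j = 0 then x ` {1..n} \<union> B else {S j})"
  define D where "D = star_hull (x ` {1..n} \<union> B)"
  define E where "E = star_hull (\<Union>j\<in>{0..n} - {0}. A j)"
  have "free_family \<tau> {0..n} A"
    using S unfolding free_semicirculars_def A_def by blast
  moreover have "A 0 = x ` {1..n} \<union> B" by (simp add: A_def)
  ultimately have free: "free_family \<tau> UNIV (\<lambda>s. if s then E else D)"
    using free_family_complement[of "{0..n}" A 0] by (simp only: E_def D_def) simp
  have Y': "Y \<in> L2_cauchy \<tau>" using Y(1) by (simp add: score_vector_def)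
  obtain r where r: "(\<lambda>k. phi_norm \<tau> (Y k)) \<longlonglongrightarrow> r"
    using convergent_phi_norm[OF Y'] by (auto simp: convergent_def)
  obtain F where F: "\<And>w. (\<lambda>k. \<tau> (Y k * w)) \<longlonglongrightarrow> F w" "\<And>u v. F (u + v) = F u + F v"
    "\<And>c u. F (c *\<^sub>C u) = c * F u" "\<And>w. cmod (F w) \<le> r * phi_norm \<tau> w"
    by (rule vector_functional[OF Y' r]) (rule that)
  have F_words: "F (nc_word x b w) = nc_diff x i b w 1 1" if "b \<in> B" "w \<in> lists ({1..n} \<times> B)" for b w
    using Y(1) that by (intro LIMSEQ_unique[OF F(1)]) (simp only: score_vector_def)
  have D: "unital_star_subalgebra D" "fst ` ?Gen \<subseteq> D"
    unfolding D_def by (auto intro: hull_inc star_hull_subalgebra)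
  have E: "unital_star_subalgebra E" unfolding E_def by (rule star_hull_subalgebra)
  let ?G = "diff_graph (?Gen \<union> (\<lambda>e. (e, 0)) ` E)"
  have y: "(?y j, \<lambda>y z. if j = i then \<tau> y * \<tau> z else 0) \<in> ?G" if j: "j \<in> {1..n}" for j
  proof -
    have "S j \<in> E" using j by (auto simp: E_def A_def intro!: hull_inc bexI[of _ j])
    then have "(s *\<^sub>R S j, \<lambda>y z. 0) \<in> ?G"
      using unital_star_subalgebraD(8)[OF E] by (intro diff_graph_null_generator) auto
    moreover have "(x j, \<lambda>y z. (if j = i then 1 else 0) * \<tau> y * \<tau> z) \<in> ?G"
      using j by (intro diff_graph_generator) auto
    moreover have "(\<lambda>y z. (if j = i then 1 else 0) * \<tau> y * \<tau> z + 0) = (\<lambda>y z. if j = i then \<tau> y * \<tau> z else 0)"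
      by (intro ext) simp
    ultimately show ?thesis using diff_graph.add by fastforce
  qed
  have "F (nc_word ?y b w) = nc_diff ?y i b w 1 1" if bw: "b \<in> B" "w \<in> lists ({1..n} \<times> B)" for b w
  proof (rule free_extension_of_conjugate_relation[where X = Y and F = F and u = "nc_word ?y b w"
        and \<alpha> = "nc_diff ?y i b w", OF D E free])
    show "range Y \<subseteq> D" using Y(2) by (simp add: D_def)
    show "(nc_word ?y b w, nc_diff ?y i b w) \<in> ?G"
      by (rule nc_word_diff_graph[OF _ y bw]) (auto intro: diff_graph_null_generator)
    show "F u = \<alpha> 1 1" if "(u, \<alpha>) \<in> diff_graph ?Gen" for u \<alpha>
      using diff_graph_eval_words[where F = F, OF B F_words F(2,3) that] .
  qed (rule F)+
  then have "(\<lambda>k. \<tau> (Y k * nc_word ?y b w)) \<longlonglongrightarrow> nc_diff ?y i b w 1 1"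
    if "b \<in> B" "w \<in> lists ({1..n} \<times> B)" for b w
    using F(1)[of "nc_word ?y b w"] that by simp
  then show ?thesis
    unfolding score_vector_def using Y' by blast
qed

lemma semicircular_power:
  "standard_semicircular \<tau> s \<Longrightarrow> \<tau> (s ^ k) = complex_of_real (semicircle_moment k)"
  by (simp add: standard_semicircular_def semicircle_moment_def)

lemma semicircular_mean: "standard_semicircular \<tau> s \<Longrightarrow> \<tau> s = 0"
  using semicircular_power[of s 1] semicircle_moment_1 by simp

lemma semicircular_variance: "standard_semicircular \<tau> s \<Longrightarrow> \<tau> (s * s) = 1"
  using semicircular_power[of s 2] semicircle_moment_step[of 0] semicircle_moment_0
  by (simp add: power2_eq_square numeral_2_eq_2[symmetric])

text \<open>A semicircular variable is its own conjugate variable, and the free extension by everything else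
  makes \<open>T\<^sub>i / \<surd>t\<close> a score vector of \<open>x i + \<surd>t T\<^sub>i\<close>.\<close>

lemma score_vector_semicircular:
  assumes T: "free_semicirculars \<tau> n T (x ` {1..n} \<union> B)" and i: "i \<in> {1..n}" and t: "t > 0"
  shows "score_vector {1..n} (\<lambda>j. x j + sqrt t *\<^sub>R T j) B i (\<lambda>k. (1 / sqrt t) *\<^sub>R T i)"
proof -
  let ?y = "\<lambda>j. x j + sqrt t *\<^sub>R T j"
  define \<kappa> where "\<kappa> = complex_of_real (1 / sqrt t)"
  let ?Gen = "{(T i, \<kappa>)}"
  define A where "A = (\<lambda>j. if j = 0 then x ` {1..n} \<union> B else {T j})"
  define D where "D = star_hull {T i}"
  define E where "E = star_hull (\<Union>j\<in>{0..n} - {i}. A j)"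
  have semicircular: "standard_semicircular \<tau> (T i)"
    using T i by (simp add: free_semicirculars_def)
  have "free_family \<tau> {0..n} A"
    using T unfolding free_semicirculars_def A_def by blast
  moreover have "A i = {T i}" using i by (simp add: A_def)
  ultimately have free: "free_family \<tau> UNIV (\<lambda>s. if s then E else D)"
    using free_family_complement[of "{0..n}" A i] i by (simp only: E_def D_def) simp
  have D: "unital_star_subalgebra D" "fst ` ?Gen \<subseteq> D" and T_D: "(1 / sqrt t) *\<^sub>R T i \<in> D"
    unfolding D_def by (auto intro: hull_inc star_hull_subalgebra
        unital_star_subalgebraD(8)[OF star_hull_subalgebra])
  have E: "unital_star_subalgebra E" unfolding E_def by (rule star_hull_subalgebra)
  have E_B: "b \<in> E" if "b \<in> B" for b
    using that i by (auto simp: E_def A_def intro!: hull_inc bexI[of _ 0])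
  have E_x: "x j \<in> E" if "j \<in> {1..n}" for j
    using that i by (auto simp: E_def A_def intro!: hull_inc bexI[of _ 0])
  have E_T: "T j \<in> E" if "j \<in> {1..n}" "j \<noteq> i" for j
    using that by (auto simp: E_def A_def intro!: hull_inc bexI[of _ j])
  define F where "F w = \<tau> ((1 / sqrt t) *\<^sub>R T i * w)" for w
  have F_linear: "F (u + v) = F u + F v" "F (c *\<^sub>C u) = c * F u" for u v c
    by (simp_all add: F_def distrib_left mult_scaleC_right tr_add tr_scaleC)
  have F_D: "F u = \<alpha> 1 1" if "(u, \<alpha>) \<in> diff_graph ?Gen" for u \<alpha>
  proof -
    define \<delta> where "\<delta> k y z = (\<Sum>m<k. \<kappa> * \<tau> (y * T i ^ m) * \<tau> (T i ^ (k - 1 - m) * z))" for k y z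
    define N where "N = range (\<lambda>k. (T i ^ k, \<delta> k))"
    have N: "(T i ^ k, \<delta> k) \<in> pair_span N" for k
      by (intro pair_span.base) (auto simp: N_def)
    have "diff_graph ?Gen \<subseteq> pair_span N"
    proof (rule diff_graph_subset_pair_span)
      show "(1, \<lambda>y z. 0) \<in> pair_span N" using N[of 0] by (simp add: \<delta>_def[abs_def])
      fix g \<kappa>' v \<beta> assume "(g, \<kappa>') \<in> ?Gen" and "(v, \<beta>) \<in> N"
      then obtain k where k: "v = T i ^ k" "\<beta> = \<delta> k" and g: "g = T i" "\<kappa>' = \<kappa>"
        by (auto simp: N_def)
      have "\<delta> (Suc k) = (\<lambda>y z. \<kappa> * \<tau> y * \<tau> (T i ^ k * z) + \<delta> k (y * T i) z)"
        by (intro ext) (simp add: \<delta>_def sum.lessThan_Suc_shift mult.assoc del: sum.lessThan_Suc)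
      then show "(g * v, \<lambda>y z. \<kappa>' * \<tau> y * \<tau> (v * z) + \<beta> (y * g) z) \<in> pair_span N"
        using N[of "Suc k"] by (simp add: k g)
    qed
    with that have "(u, \<alpha>) \<in> pair_span N" by blast
    moreover have "F v = \<beta> 1 1" if "(v, \<beta>) \<in> N" for v \<beta>
    proof -
      obtain k where k: "v = T i ^ k" "\<beta> = \<delta> k" using \<open>(v, \<beta>) \<in> N\<close> by (auto simp: N_def)
      have "F v = \<kappa> * \<tau> (T i ^ Suc k)"
        by (simp add: F_def k \<kappa>_def tr_scaleR)
      also have "\<dots> = \<beta> 1 1"
        unfolding k(2) \<delta>_def
        by (simp only: semicircular_power[OF semicircular] semicircle_moment_Suc mult_1 mult_1_right
            of_real_sum of_real_mult sum_distrib_left mult.assoc)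
      finally show ?thesis .
    qed
    ultimately show ?thesis using pair_span_eval[of u \<alpha> N F] F_linear by blast
  qed
  let ?G = "diff_graph (?Gen \<union> (\<lambda>e. (e, 0)) ` E)"
  have null: "(e, \<lambda>y z. 0) \<in> ?G" if "e \<in> E" for e
    using that by (intro diff_graph_null_generator) auto
  have y: "(?y j, \<lambda>y z. if j = i then \<tau> y * \<tau> z else 0) \<in> ?G" if j: "j \<in> {1..n}" for j
  proof (cases "j = i")
    case False
    then have "?y j \<in> E"
      using E_x[OF j] E_T[OF j] unital_star_subalgebraD(2,8)[OF E] by blast
    then show ?thesis using null False by simp
  next
    case True
    have "(T i, \<lambda>y z. \<kappa> * \<tau> y * \<tau> z) \<in> ?G" by (intro diff_graph_generator) auto
    from diff_graph.add[OF null[OF E_x[OF i]] diff_graph.scale[OF this, of "complex_of_real (sqrt t)"]]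
    have "(?y i, \<lambda>y z. 0 + complex_of_real (sqrt t) * (\<kappa> * \<tau> y * \<tau> z)) \<in> ?G"
      by (simp add: scaleC_of_real)
    moreover have "complex_of_real (sqrt t) * \<kappa> = 1"
      using t by (simp add: \<kappa>_def)
    then have "(\<lambda>y z. 0 + complex_of_real (sqrt t) * (\<kappa> * \<tau> y * \<tau> z)) = (\<lambda>y z. \<tau> y * \<tau> z)"
      by (simp add: mult.assoc[symmetric])
    ultimately show ?thesis using True by simp
  qed
  have "F (nc_word ?y b w) = nc_diff ?y i b w 1 1" if bw: "b \<in> B" "w \<in> lists ({1..n} \<times> B)" for b w
  proof (rule free_extension_of_conjugate_relation[where X = "\<lambda>k. (1 / sqrt t) *\<^sub>R T i" and F = F
        and u = "nc_word ?y b w" and \<alpha> = "nc_diff ?y i b w", OF D E free])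
    show "range (\<lambda>k::nat. (1 / sqrt t) *\<^sub>R T i) \<subseteq> D" using T_D by auto
    show "(\<lambda>k. \<tau> ((1 / sqrt t) *\<^sub>R T i * w)) \<longlonglongrightarrow> F w" for w by (simp add: F_def)
    show "(nc_word ?y b w, nc_diff ?y i b w) \<in> ?G"
      by (rule nc_word_diff_graph[OF null[OF E_B] y bw])
  qed (rule F_D F_linear, assumption?)+
  then have "(\<lambda>k. \<tau> ((1 / sqrt t) *\<^sub>R T i * nc_word ?y b w)) \<longlonglongrightarrow> nc_diff ?y i b w 1 1"
    if "b \<in> B" "w \<in> lists ({1..n} \<times> B)" for b w
    using that by (simp only: F_def tendsto_const)
  then show ?thesis
    unfolding score_vector_def using L2_cauchy_const by blast
qed

lemma phi_norm_semicircular: "standard_semicircular \<tau> s \<Longrightarrow> phi_norm \<tau> (r *\<^sub>R s) = \<bar>r\<bar>"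
  using semicircular_variance[of s]
  by (simp add: phi_norm_scaleR) (simp add: phi_norm_def standard_semicircular_def)

lemma square_free_perturbation:
  assumes S: "free_semicirculars \<tau> n S (x ` {1..n} \<union> B)" and i: "i \<in> {1..n}"
  shows "\<tau> ((x i + s *\<^sub>R S i) * (x i + s *\<^sub>R S i)) = \<tau> (x i * x i) + complex_of_real (s\<^sup>2)"
proof -
  let ?X = "\<lambda>j. if j = 0 then x ` {1..n} \<union> B else {S j}"
  have free: "free_family \<tau> {0..n} ?X" and semicircular: "standard_semicircular \<tau> (S i)"
    using S i unfolding free_semicirculars_def by blast+
  have x: "x i \<in> star_hull (?X 0)" using i by (auto intro!: hull_inc)
  have "\<tau> (prod_list (map snd [(0::nat, x i - \<tau> (x i) *\<^sub>C 1), (i, S i)])) = 0"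
    using centered_member[OF star_hull_subalgebra x] semicircular_mean[OF semicircular] i
    by (intro free_familyD[OF free]) (auto simp: centered_alternating_Cons intro!: hull_inc)
  then have "\<tau> (x i * S i) = 0"
    using semicircular_mean[OF semicircular]
    by (simp add: left_diff_distrib mult_scaleC_left tr_diff tr_scaleC)
  then show ?thesis
    using semicircular_variance[OF semicircular] tr_commute[of "S i" "x i"]
    by (simp add: distrib_left distrib_right tr_add tr_scaleR power2_eq_square)
qed

end


section \<open>Passing to an enlargement\<close>

lemma tracial_wstar_probability_space_tracial_state:
  assumes "tracial_wstar_probability_space P \<phi>"
  shows "tracial_state \<phi>"
proof -
  have "wstar_algebra P" "\<phi> \<in> P"
    and state: "\<phi> 1 = 1" "\<forall>x. \<phi> (star x * x) \<in> \<real>\<^sub>\<ge>\<^sub>0" "\<forall>x y. \<phi> (x * y) = \<phi> (y * x)"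
    using assms unfolding tracial_wstar_probability_space_def by blast+
  moreover from \<open>wstar_algebra P\<close> have "P \<subseteq> norm_dual"
    unfolding wstar_algebra_def by (rule conjunct1)
  ultimately have "\<phi> \<in> norm_dual" by blast
  then have linear: "bounded_linear \<phi>" "\<forall>c x. \<phi> (c *\<^sub>C x) = c * \<phi> x"
    by (simp_all add: norm_dual_def)
  show ?thesis
  proof
    show "\<phi> (x + y) = \<phi> x + \<phi> y" for x y
      using linear(1) by (rule linear_add[OF bounded_linear.linear])
  qed (use linear(2) state in blast)+
qed

lemma score_vector_enlargement:
  fixes \<iota> :: "'a::cstar_algebra \<Rightarrow> 'b::cstar_algebra"
  assumes enl: "wstar_enlargement P \<phi> Q \<tau> \<iota>"
    and Y: "tracial_state.score_vector \<phi> I a B i Y" "range Y \<subseteq> star_hull (a ` I \<union> B)"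
      "(\<lambda>k. phi_norm \<phi> (Y k)) \<longlonglongrightarrow> r"
  shows "tracial_state.score_vector \<tau> I (\<lambda>i. \<iota> (a i)) (\<iota> ` B) i (\<lambda>k. \<iota> (Y k))"
    "range (\<lambda>k. \<iota> (Y k)) \<subseteq> star_hull ((\<lambda>i. \<iota> (a i)) ` I \<union> \<iota> ` B)"
    "(\<lambda>k. phi_norm \<tau> (\<iota> (Y k))) \<longlonglongrightarrow> r"
proof -
  interpret \<phi>: tracial_state \<phi>
    using enl unfolding wstar_enlargement_def by (blast intro: tracial_wstar_probability_space_tracial_state)
  interpret \<tau>: tracial_state \<tau>
    using enl unfolding wstar_enlargement_def by (blast intro: tracial_wstar_probability_space_tracial_state)
  have hom: "\<iota> 1 = 1" "\<iota> (x + y) = \<iota> x + \<iota> y" "\<iota> (c *\<^sub>C x) = c *\<^sub>C \<iota> x" "\<iota> (x * y) = \<iota> x * \<iota> y"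
    "\<iota> (star x) = star (\<iota> x)" "\<tau> (\<iota> x) = \<phi> x" for x y c
    using enl by (auto simp: wstar_enlargement_def)
  have hom_diff: "\<iota> (x - y) = \<iota> x - \<iota> y" for x y
    using hom(2)[of "x - y" y] by simp
  have norm: "phi_norm \<tau> (\<iota> x) = phi_norm \<phi> x" for x
    by (simp add: phi_norm_def flip: hom)
  show "(\<lambda>k. phi_norm \<tau> (\<iota> (Y k))) \<longlonglongrightarrow> r" using Y(3) by (simp add: norm)
  define H where "H = star_hull ((\<lambda>i. \<iota> (a i)) ` I \<union> \<iota> ` B)"
  have "unital_star_subalgebra H" unfolding H_def by (rule star_hull_subalgebra)
  note H = unital_star_subalgebraD[OF this]
  have "star_hull (a ` I \<union> B) \<subseteq> {u. \<iota> u \<in> H}"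
  proof (rule hull_minimal)
    show "a ` I \<union> B \<subseteq> {u. \<iota> u \<in> H}" by (auto simp: H_def intro: hull_inc)
    show "unital_star_subalgebra {u. \<iota> u \<in> H}"
      unfolding unital_star_subalgebra_def by (intro conjI ballI allI; simp add: hom H)
  qed
  then show "range (\<lambda>k. \<iota> (Y k)) \<subseteq> star_hull ((\<lambda>i. \<iota> (a i)) ` I \<union> \<iota> ` B)"
    using Y(2) unfolding H_def by auto
  let ?\<iota>w = "map (\<lambda>(i, c). (i, \<iota> c))"
  have word: "nc_word (\<lambda>i. \<iota> (a i)) (\<iota> b) (?\<iota>w w) = \<iota> (nc_word a b w)" for b w
    by (induction w arbitrary: b) (auto simp: nc_word_Cons hom)
  have diff: "\<phi>.nc_diff a i b w 1 1 = \<tau>.nc_diff (\<lambda>i. \<iota> (a i)) i (\<iota> b) (?\<iota>w w) 1 1" for b w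
    unfolding \<phi>.nc_diff_one \<tau>.nc_diff_one
    by (auto intro!: sum.cong simp: word take_map drop_map case_prod_beta hom(6))
  have letters: "I \<times> \<iota> ` B = (\<lambda>(i, c). (i, \<iota> c)) ` (I \<times> B)" by force
  show "\<tau>.score_vector I (\<lambda>i. \<iota> (a i)) (\<iota> ` B) i (\<lambda>k. \<iota> (Y k))"
    unfolding \<tau>.score_vector_def
  proof (intro conjI ballI)
    show "(\<lambda>k. \<iota> (Y k)) \<in> L2_cauchy \<tau>"
      using Y(1) by (simp add: \<phi>.score_vector_def L2_cauchy_def norm flip: hom_diff)
    fix b' w' assume "b' \<in> \<iota> ` B" "w' \<in> lists (I \<times> \<iota> ` B)"
    then obtain b w where bw: "b \<in> B" "w \<in> lists (I \<times> B)" "b' = \<iota> b" "w' = ?\<iota>w w"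
      unfolding letters lists_image by blast
    have "(\<lambda>k. \<phi> (Y k * nc_word a b w)) \<longlonglongrightarrow> \<phi>.nc_diff a i b w 1 1"
      using Y(1) bw unfolding \<phi>.score_vector_def by blast
    then show "(\<lambda>k. \<tau> (\<iota> (Y k) * nc_word (\<lambda>i. \<iota> (a i)) b' w')) \<longlonglongrightarrow> \<tau>.nc_diff (\<lambda>i. \<iota> (a i)) i b' w' 1 1"
      unfolding bw(3,4) word diff hom(4)[symmetric] hom(6) .
  qed
qed

lemma unital_star_subalgebra_image:
  assumes enl: "wstar_enlargement P \<phi> Q \<tau> \<iota>" and B: "unital_star_subalgebra B"
  shows "unital_star_subalgebra (\<iota> ` B)"
proof -
  have hom: "\<iota> x + \<iota> y = \<iota> (x + y)" "c *\<^sub>C \<iota> x = \<iota> (c *\<^sub>C x)" "\<iota> x * \<iota> y = \<iota> (x * y)"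
    "star (\<iota> x) = \<iota> (star x)" for x y c
    using enl by (auto simp: wstar_enlargement_def)
  have "1 \<in> \<iota> ` B"
    using enl unital_star_subalgebraD(1)[OF B] by (auto simp: wstar_enlargement_def intro!: image_eqI[of _ _ 1])
  then show ?thesis
    unfolding unital_star_subalgebra_def using unital_star_subalgebraD[OF B] by (auto simp: hom)
qed


section \<open>Boundedness of the free entropy\<close>

text \<open>The positive and the negative part are integrated separately, and each of them is dominated by
  \<open>G / (1 + t)\<^sup>2\<close>, whose integral over the half-line is \<open>G\<close>.\<close>

lemma ereal_integral_bounded:
  assumes G: "G \<ge> 0" and f: "\<And>t. t > 0 \<Longrightarrow> \<exists>r. f t = ereal r \<and> \<bar>r\<bar> \<le> G / (1 + t)\<^sup>2"
  shows "\<exists>r. ereal_integral (restrict_space lborel {0<..}) f = ereal r \<and> \<bar>r\<bar> \<le> G"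
proof -
  have "(\<integral>\<^sup>+t. ennreal (G / (1 + t)\<^sup>2) * indicator {0..} t \<partial>lborel) = ennreal (0 - (- G / (1 + 0)))"
  proof (rule nn_integral_FTC_atLeast[where F = "\<lambda>t. - G / (1 + t)"])
    show "(\<lambda>t. G / (1 + t)\<^sup>2) \<in> borel_measurable borel" by measurable
    show "((\<lambda>t. - G / (1 + t)) has_real_derivative G / (1 + t)\<^sup>2) (at t)" if "0 \<le> t" for t
      using that by (auto intro!: derivative_eq_intros simp: power2_eq_square divide_simps)
    show "0 \<le> G / (1 + t)\<^sup>2" for t using G by simp
    show "((\<lambda>t. - G / (1 + t)) \<longlongrightarrow> 0) at_top" by real_asymp
  qed
  then have G_int: "(\<integral>\<^sup>+t. ennreal (G / (1 + t)\<^sup>2) * indicator {0..} t \<partial>lborel) = ennreal G" by simp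
  have le: "(\<integral>\<^sup>+t. h t \<partial>restrict_space lborel {0<..}) \<le> ennreal G"
    if h: "\<And>t. t > 0 \<Longrightarrow> h t \<le> ennreal (G / (1 + t)\<^sup>2)" for h :: "real \<Rightarrow> ennreal"
  proof -
    have "(\<integral>\<^sup>+t. h t \<partial>restrict_space lborel {0<..}) = (\<integral>\<^sup>+t. h t * indicator {0<..} t \<partial>lborel)"
      by (intro nn_integral_restrict_space) simp
    also have "\<dots> \<le> (\<integral>\<^sup>+t. ennreal (G / (1 + t)\<^sup>2) * indicator {0..} t \<partial>lborel)"
      using h by (intro nn_integral_mono) (auto simp: indicator_def)
    finally show ?thesis using G_int by simp
  qed
  define p q where "p = (\<integral>\<^sup>+t. e2ennreal (f t) \<partial>restrict_space lborel {0<..})"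
    and "q = (\<integral>\<^sup>+t. e2ennreal (- f t) \<partial>restrict_space lborel {0<..})"
  have "e2ennreal (f t) \<le> ennreal (G / (1 + t)\<^sup>2)" "e2ennreal (- f t) \<le> ennreal (G / (1 + t)\<^sup>2)"
    if "t > 0" for t
    using f[OF that] by (auto simp: e2ennreal_ereal intro!: ennreal_leI)
  then have "p \<le> ennreal G" "q \<le> ennreal G" unfolding p_def q_def by (intro le; simp)+
  then obtain p' q' where "p = ennreal p'" "0 \<le> p'" "p' \<le> G" "q = ennreal q'" "0 \<le> q'" "q' \<le> G"
    using G by (cases p; cases q) (auto simp: top_unique)
  then have "ereal_integral (restrict_space lborel {0<..}) f = ereal (p' - q')" "\<bar>p' - q'\<bar> \<le> G"
    unfolding ereal_integral_def p_def[symmetric] q_def[symmetric] by (auto simp: enn2ereal_ennreal)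
  then show ?thesis by blast
qed

text \<open>The bound \<open>n / (c + t)\<close> controls the positive part of the integrand, which is at most
  \<open>n (c - 1) / (1 + t)\<^sup>2\<close>. The negative part is at most \<open>K\<close>, used for \<open>t \<le> 1\<close>, and at most
  \<open>n / (t (1 + t))\<close>, used for \<open>t > 1\<close>.\<close>

lemma chi_star_bounded:
  assumes K: "K \<ge> 0" and c: "c \<ge> 1"
    and up: "\<And>t. t > 0 \<Longrightarrow> free_fisher \<tau> {1..n} (\<lambda>i. y i + sqrt t *\<^sub>R T i) B \<le> ennreal K"
      "\<And>t. t > 0 \<Longrightarrow> free_fisher \<tau> {1..n} (\<lambda>i. y i + sqrt t *\<^sub>R T i) B \<le> ennreal (n / t)"
    and low: "\<And>t. t > 0 \<Longrightarrow> ennreal (n / (c + t)) \<le> free_fisher \<tau> {1..n} (\<lambda>i. y i + sqrt t *\<^sub>R T i) B"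
  shows "\<exists>r. chi_star \<tau> n y B T = ereal r \<and>
    \<bar>r\<bar> \<le> (4 * K + 4 * real n + real n * c) / 2 + \<bar>n / 2 * ln (2 * pi * exp 1)\<bar>"
proof -
  define G where "G = 4 * K + 4 * real n + real n * c"
  let ?f = "\<lambda>t. ereal (n / (1 + t)) - enn2ereal (free_fisher \<tau> {1..n} (\<lambda>i. y i + sqrt t *\<^sub>R T i) B)"
  have "\<exists>r. ?f t = ereal r \<and> \<bar>r\<bar> \<le> G / (1 + t)\<^sup>2" if t: "t > 0" for t
  proof -
    define \<Phi> where "\<Phi> = free_fisher \<tau> {1..n} (\<lambda>i. y i + sqrt t *\<^sub>R T i) B"
    have \<Phi>: "\<Phi> \<le> ennreal K" "\<Phi> \<le> ennreal (n / t)" "ennreal (n / (c + t)) \<le> \<Phi>"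
      unfolding \<Phi>_def by (rule up[OF t] low[OF t])+
    obtain p where p: "\<Phi> = ennreal p" "p \<ge> 0"
      using \<Phi>(1) by (cases \<Phi>) (auto simp: top_unique)
    have p_le: "p \<le> K" "p \<le> n / t" and p_ge: "n / (c + t) \<le> p"
      using \<Phi> K t p(2) by (simp_all add: p(1) ennreal_le_iff)
    have "n / (1 + t) - p \<le> G / (1 + t)\<^sup>2"
    proof -
      have "n / (1 + t) - p \<le> n / (1 + t) - n / (c + t)" using p_ge by simp
      also have "\<dots> = n * (c - 1) / ((1 + t) * (c + t))"
        using t c by (simp add: field_simps)
      also have "\<dots> \<le> n * (c - 1) / (1 + t)\<^sup>2"
        using t c by (intro divide_left_mono) (auto simp: power2_eq_square)
      also have "\<dots> \<le> G / (1 + t)\<^sup>2"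
        using K c by (intro divide_right_mono) (auto simp: G_def algebra_simps)
      finally show ?thesis .
    qed
    moreover have "p - n / (1 + t) \<le> G / (1 + t)\<^sup>2"
    proof (cases "t \<le> 1")
      case True
      have "0 \<le> n / (1 + t)" using t by simp
      then have "p - n / (1 + t) \<le> K" using p_le(1) by linarith
      also have "K \<le> 4 * K / (1 + t)\<^sup>2"
      proof -
        have "(1 + t)\<^sup>2 \<le> 2\<^sup>2" using True t by (intro power_mono) auto
        then have "K * (1 + t)\<^sup>2 \<le> K * 4" using K by (intro mult_left_mono) auto
        then show ?thesis using t by (simp add: pos_le_divide_eq)
      qed
      also have "\<dots> \<le> G / (1 + t)\<^sup>2"
        using c by (intro divide_right_mono) (auto simp: G_def)
      finally show ?thesis .
    next
      case False
      have "p - n / (1 + t) \<le> n / t - n / (1 + t)" using p_le(2) by simp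
      also have "\<dots> = n / (t * (1 + t))" using t by (simp add: field_simps)
      also have "\<dots> \<le> 4 * n / (1 + t)\<^sup>2"
      proof -
        have "real n * (1 + t) \<le> real n * (4 * t)" using False by (intro mult_left_mono) auto
        then have "n / t \<le> 4 * n / (1 + t)"
          using t by (simp add: field_simps)
        then have "n / t / (1 + t) \<le> 4 * n / (1 + t) / (1 + t)"
          using t by (intro divide_right_mono) auto
        then show ?thesis by (simp only: divide_divide_eq_left power2_eq_square)
      qed
      also have "\<dots> \<le> G / (1 + t)\<^sup>2"
        using c K by (intro divide_right_mono) (auto simp: G_def)
      finally show ?thesis .
    qed
    ultimately have "\<bar>n / (1 + t) - p\<bar> \<le> G / (1 + t)\<^sup>2" by simp
    moreover have "?f t = ereal (n / (1 + t) - p)"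
      unfolding \<Phi>_def[symmetric] using p by simp
    ultimately show ?thesis by blast
  qed
  moreover have "G \<ge> 0" using K c by (simp add: G_def)
  ultimately obtain r where r: "ereal_integral (restrict_space lborel {0<..}) ?f = ereal r" "\<bar>r\<bar> \<le> G"
    using ereal_integral_bounded[of G ?f] by blast
  have "chi_star \<tau> n y B T = ereal (r / 2 + n / 2 * ln (2 * pi * exp 1))"
    unfolding chi_star_def r(1) by simp
  moreover have "\<bar>r / 2 + n / 2 * ln (2 * pi * exp 1)\<bar> \<le> G / 2 + \<bar>n / 2 * ln (2 * pi * exp 1)\<bar>"
    using r(2) by linarith
  ultimately show ?thesis unfolding G_def by blast
qed

lemma delta_star_eq_if_bounded:
  assumes bound: "\<And>\<epsilon>. 0 < \<epsilon> \<Longrightarrow> \<epsilon> < 1 \<Longrightarrow>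
    \<exists>r. chi_star \<tau> n (\<lambda>i. a i + \<epsilon> *\<^sub>R S i) B (T \<epsilon>) = ereal r \<and> \<bar>r\<bar> \<le> M"
  shows "delta_star \<tau> n a B S T = ereal (real n)"
proof -
  let ?chi = "\<lambda>\<epsilon>. chi_star \<tau> n (\<lambda>i. a i + \<epsilon> *\<^sub>R S i) B (T \<epsilon>)"
  define h where "h \<epsilon> = real_of_ereal (?chi \<epsilon>)" for \<epsilon>
  have h: "?chi \<epsilon> = ereal (h \<epsilon>)" "\<bar>h \<epsilon>\<bar> \<le> M" if "0 < \<epsilon>" "\<epsilon> < 1" for \<epsilon>
    using bound[OF that] by (auto simp: h_def)
  have ev: "\<forall>\<^sub>F \<epsilon> in at_right 0. 0 < \<epsilon> \<and> \<epsilon> < (1::real)"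
    using eventually_at_right_less[of "0::real"] by (auto simp: eventually_at_right_field intro: exI[of _ 1])
  have "((\<lambda>\<epsilon>. h \<epsilon> / \<bar>ln \<epsilon>\<bar>) \<longlongrightarrow> 0) (at_right 0)"
  proof (rule Lim_null_comparison)
    show "\<forall>\<^sub>F \<epsilon> in at_right 0. norm (h \<epsilon> / \<bar>ln \<epsilon>\<bar>) \<le> M / \<bar>ln \<epsilon>\<bar>"
      using ev
    proof eventually_elim
      case (elim \<epsilon>)
      then have "\<bar>h \<epsilon>\<bar> / \<bar>ln \<epsilon>\<bar> \<le> M / \<bar>ln \<epsilon>\<bar>"
        by (intro divide_right_mono h) auto
      then show ?case by (simp only: real_norm_def abs_divide abs_idempotent)
    qed
    show "((\<lambda>\<epsilon>. M / \<bar>ln \<epsilon>\<bar>) \<longlongrightarrow> 0) (at_right 0)" by real_asymp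
  qed
  then have "((\<lambda>\<epsilon>. ereal (h \<epsilon> / \<bar>ln \<epsilon>\<bar>)) \<longlongrightarrow> ereal 0) (at_right 0)"
    by (simp only: tendsto_ereal)
  moreover have "\<forall>\<^sub>F \<epsilon> in at_right 0. ereal (h \<epsilon> / \<bar>ln \<epsilon>\<bar>) = ?chi \<epsilon> / ereal \<bar>ln \<epsilon>\<bar>"
    using ev by eventually_elim (simp add: h(1))
  ultimately have "((\<lambda>\<epsilon>. ?chi \<epsilon> / ereal \<bar>ln \<epsilon>\<bar>) \<longlongrightarrow> ereal 0) (at_right 0)"
    by (rule Lim_transform_eventually)
  then have "Limsup (at_right 0) (\<lambda>\<epsilon>. ?chi \<epsilon> / ereal \<bar>ln \<epsilon>\<bar>) = ereal 0"
    by (intro lim_imp_Limsup) (simp_all add: trivial_limit_at_right_real)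
  then show ?thesis unfolding delta_star_def by simp
qed

text \<open>Score vectors of \<open>x\<close> pass to \<open>x + \<epsilon> S\<close> and, after projection to the algebra of \<open>x + \<epsilon> S\<close> and \<open>B\<close>,
  to \<open>x + \<epsilon> S + \<surd>t T\<close>. The projection comes in between because \<open>T\<close> is assumed free from that algebra,
  while the score vectors of \<open>x\<close> may lie outside its closure. The resulting bound is the same for all \<open>\<epsilon> < 1\<close>.\<close>

lemma (in tracial_state) chi_star_perturbation_bounded:
  assumes B: "unital_star_subalgebra B" and x: "\<And>i. i \<in> {1..n} \<Longrightarrow> star (x i) = x i"
    and S: "free_semicirculars \<tau> n S (x ` {1..n} \<union> B)"
    and T: "free_semicirculars \<tau> n T ((\<lambda>i. x i + \<epsilon> *\<^sub>R S i) ` {1..n} \<union> B)"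
    and \<epsilon>: "0 < \<epsilon>" "\<epsilon> < 1"
    and Y: "\<And>i. i \<in> {1..n} \<Longrightarrow> score_vector {1..n} x B i (Y i)"
      "\<And>i. i \<in> {1..n} \<Longrightarrow> range (Y i) \<subseteq> star_hull (x ` {1..n} \<union> B)"
      "\<And>i. i \<in> {1..n} \<Longrightarrow> (\<lambda>k. phi_norm \<tau> (Y i k)) \<longlonglongrightarrow> r i"
  defines "K \<equiv> \<Sum>i\<in>{1..n}. (r i)\<^sup>2" and "c \<equiv> 1 + (\<Sum>i\<in>{1..n}. (phi_norm \<tau> (x i))\<^sup>2)"
  shows "\<exists>r. chi_star \<tau> n (\<lambda>i. x i + \<epsilon> *\<^sub>R S i) B T = ereal r \<and>
    \<bar>r\<bar> \<le> (4 * K + 4 * real n + real n * c) / 2 + \<bar>n / 2 * ln (2 * pi * exp 1)\<bar>"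
proof (rule chi_star_bounded)
  let ?y = "\<lambda>i. x i + \<epsilon> *\<^sub>R S i" and ?z = "\<lambda>t i. (x i + \<epsilon> *\<^sub>R S i) + sqrt t *\<^sub>R T i"
  have semicircular: "standard_semicircular \<tau> (S i)" "standard_semicircular \<tau> (T i)" if "i \<in> {1..n}" for i
    using S T that unfolding free_semicirculars_def by blast+
  have y: "star (?y i) = ?y i" if "i \<in> {1..n}" for i
    using semicircular[OF that] x[OF that] by (simp add: standard_semicircular_def star_add star_scaleR)
  have z: "star (?z t i) = ?z t i" if "i \<in> {1..n}" for i t
    using semicircular[OF that] y[OF that] by (simp only: standard_semicircular_def star_add[of "?y i"] star_scaleR)
  show "K \<ge> 0" "c \<ge> 1" by (simp_all add: K_def c_def sum_nonneg)
  fix t :: real assume t: "t > 0"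
  let ?score = "\<lambda>i Z s. score_vector {1..n} ?y B i Z \<and> range Z \<subseteq> star_hull (?y ` {1..n} \<union> B) \<and>
      (\<lambda>k. phi_norm \<tau> (Z k)) \<longlonglongrightarrow> s \<and> s \<le> r i"
  have "\<exists>Z s. ?score i Z s" if i: "i \<in> {1..n}" for i
  proof -
    have X: "score_vector {1..n} ?y B i (Y i)"
      using Y[OF i] by (intro score_vector_free_perturbation[OF B S])
    obtain Z s where "score_vector {1..n} ?y B i Z" "range Z \<subseteq> star_hull (?y ` {1..n} \<union> B)"
      "(\<lambda>k. phi_norm \<tau> (Z k)) \<longlonglongrightarrow> s" "s \<le> r i"
      by (rule score_vector_projection[OF B y X Y(3)[OF i]]) (assumption | rule that)+
    then show ?thesis by (intro exI conjI)
  qed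
  then have "\<forall>i\<in>{1..n}. \<exists>Z s. ?score i Z s" by blast
  from bchoice[OF this] obtain Z where "\<forall>i\<in>{1..n}. \<exists>s. ?score i (Z i) s" by blast
  from bchoice[OF this] obtain s where "\<forall>i\<in>{1..n}. ?score i (Z i) (s i)" by blast
  then have Z: "score_vector {1..n} ?y B i (Z i)" "range (Z i) \<subseteq> star_hull (?y ` {1..n} \<union> B)"
      "(\<lambda>k. phi_norm \<tau> (Z i k)) \<longlonglongrightarrow> s i" "s i \<le> r i" if "i \<in> {1..n}" for i
    using that by blast+
  have s_nonneg: "0 \<le> s i" if "i \<in> {1..n}" for i
    using Z(3)[OF that] by (intro LIMSEQ_le_const) auto
  have "free_fisher \<tau> {1..n} (?z t) B \<le> ennreal (\<Sum>i\<in>{1..n}. (s i)\<^sup>2)"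
    using Z by (intro free_fisher_le[OF _ B z] score_vector_free_perturbation[OF B T]) auto
  also have "\<dots> \<le> ennreal K"
    unfolding K_def using Z(4) s_nonneg by (intro ennreal_leI sum_mono power_mono)
  finally show "free_fisher \<tau> {1..n} (?z t) B \<le> ennreal K" .
  have "(\<lambda>k. phi_norm \<tau> ((1 / sqrt t) *\<^sub>R T i)) \<longlonglongrightarrow> 1 / sqrt t" if "i \<in> {1..n}" for i
    using semicircular(2)[OF that] t by (simp add: phi_norm_semicircular)
  then have "free_fisher \<tau> {1..n} (?z t) B \<le> ennreal (\<Sum>i\<in>{1..n}. (1 / sqrt t)\<^sup>2)"
    using score_vector_semicircular[OF T _ t] by (intro free_fisher_le[OF _ B z]) auto
  also have "(\<Sum>i\<in>{1..n}. (1 / sqrt t)\<^sup>2) = n / t"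
    using t by (simp add: power_divide)
  finally show "free_fisher \<tau> {1..n} (?z t) B \<le> ennreal (n / t)" .
  have "Re (\<tau> (?z t i * ?z t i)) \<le> c + t" if i: "i \<in> {1..n}" for i
  proof -
    have "Re (\<tau> (?z t i * ?z t i)) = (phi_norm \<tau> (x i))\<^sup>2 + \<epsilon>\<^sup>2 + t"
      using square_free_perturbation[OF T i, of "sqrt t"] square_free_perturbation[OF S i, of \<epsilon>] t x[OF i]
      by (simp add: phi_norm_square)
    also have "\<dots> \<le> (phi_norm \<tau> (x i))\<^sup>2 + 1 + t"
      using \<epsilon> by (simp add: power_le_one)
    also have "(phi_norm \<tau> (x i))\<^sup>2 \<le> (\<Sum>i\<in>{1..n}. (phi_norm \<tau> (x i))\<^sup>2)"
      using i by (intro member_le_sum) auto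
    finally show ?thesis by (simp add: c_def)
  qed
  then have "ennreal (real (card {1..n}) / (c + t)) \<le> free_fisher \<tau> {1..n} (?z t) B"
    using t \<open>c \<ge> 1\<close> unital_star_subalgebraD(1)[OF B] by (intro free_fisher_ge z) auto
  then show "ennreal (n / (c + t)) \<le> free_fisher \<tau> {1..n} (?z t) B" by simp
qed

theorem corollary3p7:
  fixes \<phi> :: "'a::cstar_algebra \<Rightarrow> complex" and P :: "('a \<Rightarrow> complex) set"
    and n :: nat and a :: "nat \<Rightarrow> 'a" and B :: "'a set"
    and \<tau> :: "'b::cstar_algebra \<Rightarrow> complex" and Q :: "('b \<Rightarrow> complex) set" and \<iota> :: "'a \<Rightarrow> 'b"
    and S :: "nat \<Rightarrow> 'b" and T :: "real \<Rightarrow> nat \<Rightarrow> 'b"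
  assumes "tracial_wstar_probability_space P \<phi>"
    and "\<And>i. i \<in> {1..n} \<Longrightarrow> star (a i) = a i"
    and "unital_wstar_subalgebra P B"
    and "wstar_enlargement P \<phi> Q \<tau> \<iota>"
    and "free_semicirculars \<tau> n S ((\<lambda>i. \<iota> (a i)) ` {1..n} \<union> \<iota> ` B)"
    and "\<And>\<epsilon>. \<epsilon> > 0 \<Longrightarrow>
           free_semicirculars \<tau> n (T \<epsilon>) ((\<lambda>i. \<iota> (a i) + \<epsilon> *\<^sub>R S i) ` {1..n} \<union> \<iota> ` B)"
    and "free_fisher \<phi> {1..n} a B < \<infinity>"
  shows "delta_star \<tau> n (\<lambda>i. \<iota> (a i)) (\<iota> ` B) S T = ereal (real n)"
proof -
  interpret \<phi>: tracial_state \<phi>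
    using assms(1) by (rule tracial_wstar_probability_space_tracial_state)
  interpret \<tau>: tracial_state \<tau>
    using assms(4) unfolding wstar_enlargement_def by (blast intro: tracial_wstar_probability_space_tracial_state)
  have B: "unital_star_subalgebra (\<iota> ` B)"
    using assms(3) by (intro unital_star_subalgebra_image[OF assms(4)]) (simp add: unital_wstar_subalgebra_def)
  have a: "star (\<iota> (a i)) = \<iota> (a i)" if "i \<in> {1..n}" for i
  proof -
    have "star (\<iota> (a i)) = \<iota> (star (a i))"
      using assms(4) by (simp add: wstar_enlargement_def)
    then show ?thesis using assms(2)[OF that] by simp
  qed
  obtain \<xi> where \<xi>: "conjugate_system \<phi> {1..n} a B \<xi>"
    using assms(7) by (auto simp: free_fisher_def split: if_splits)
  let ?score = "\<lambda>i Y. \<phi>.score_vector {1..n} a B i Y \<and> range Y \<subseteq> star_hull (a ` {1..n} \<union> B) \<and>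
      (\<lambda>k. phi_norm \<phi> (Y k)) \<longlonglongrightarrow> L2_norm \<phi> (\<xi> i)"
  have "\<exists>Y. ?score i Y" if i: "i \<in> {1..n}" for i
    by (rule \<phi>.conjugate_system_score_vector[OF \<xi> i]) (intro exI conjI)
  then have "\<forall>i\<in>{1..n}. \<exists>Y. ?score i Y" by blast
  from bchoice[OF this] obtain Y where "\<forall>i\<in>{1..n}. ?score i (Y i)" by blast
  then have Y: "\<phi>.score_vector {1..n} a B i (Y i)" "range (Y i) \<subseteq> star_hull (a ` {1..n} \<union> B)"
      "(\<lambda>k. phi_norm \<phi> (Y i k)) \<longlonglongrightarrow> L2_norm \<phi> (\<xi> i)" if "i \<in> {1..n}" for i
    using that by blast+
  show ?thesis
  proof (rule delta_star_eq_if_bounded)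
    fix \<epsilon> :: real assume \<epsilon>: "0 < \<epsilon>" "\<epsilon> < 1"
    show "\<exists>r. chi_star \<tau> n (\<lambda>i. \<iota> (a i) + \<epsilon> *\<^sub>R S i) (\<iota> ` B) (T \<epsilon>) = ereal r \<and>
      \<bar>r\<bar> \<le> (4 * (\<Sum>i\<in>{1..n}. (L2_norm \<phi> (\<xi> i))\<^sup>2) + 4 * real n +
        real n * (1 + (\<Sum>i\<in>{1..n}. (phi_norm \<tau> (\<iota> (a i)))\<^sup>2))) / 2 + \<bar>n / 2 * ln (2 * pi * exp 1)\<bar>"
      by (rule \<tau>.chi_star_perturbation_bounded[OF B a assms(5) assms(6)[OF \<epsilon>(1)] \<epsilon>
            score_vector_enlargement(1)[OF assms(4) Y] score_vector_enlargement(2)[OF assms(4) Y]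
            score_vector_enlargement(3)[OF assms(4) Y]])
  qed
qed

end
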